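(* Let $n\in\mathbb{Z}$ and let $BS(n,1)=\langle a,t \mid t^{-1}a^n t=a\rangle$. Then the full automorphism group $A=\operatorname{Aut}(BS(n,1))$ is orbit decidable; that is, there is an algorithm which, given two words $u,v$ on the generators $a,t$ (elements of the free group $F(\{a,t\})$), decides whether there exists $\varphi\in\operatorname{Aut}(BS(n,1))$ such that $u\varphi=v$ in $BS(n,1)$.
   Context: Automorphisms are written with the argument on the left: $u\varphi$ denotes the image under $\varphi$ of the element represented by $u$. For a group $G$ with a finite presentation $\langle X\mid R\rangle$, a subgroup $A\leqslant\operatorname{Aut}(G)$ is called orbit decidable if there is an algorithm which, given two words $u,v\in F(X)$ on the generators, decides whether there exists $\alpha\in A$ such that $u\alpha=v$ in $G$. *)

theory Defs
  imports "HOL-Algebra.Bij" "HOL-Algebra.Generated_Groups" "HOL-Library.Nat_Bijection"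
begin

section \<open>Free groups and presentations\<close>

text \<open>
  The letter \<open>(x, False)\<close> stands for the generator \<open>x\<close> and \<open>(x, True)\<close> for its formal inverse.
  A word is any list of letters; it need not be freely reduced.
\<close>

type_synonym 'a letter = "'a \<times> bool"
type_synonym 'a word = "'a letter list"

definition inv_letter :: "'a letter \<Rightarrow> 'a letter" where
  "inv_letter l = (fst l, \<not> snd l)"

definition words :: "'a set \<Rightarrow> 'a word set" where
  "words X = lists (X \<times> UNIV)"

fun push :: "'a letter \<Rightarrow> 'a word \<Rightarrow> 'a word" where
  "push l [] = [l]"
| "push l (k # w) = (if k = inv_letter l then w else l # k # w)"

definition reduce :: "'a word \<Rightarrow> 'a word" where
  "reduce w = foldr push w []"

fun reduced :: "'a word \<Rightarrow> bool" where
  "reduced [] = True"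
| "reduced [l] = True"
| "reduced (l # k # w) = (k \<noteq> inv_letter l \<and> reduced (k # w))"

text \<open>The free group on \<open>X\<close>: reduced words under concatenation followed by free reduction.\<close>

definition free_group :: "'a set \<Rightarrow> 'a word monoid" where
  "free_group X = \<lparr>carrier = {w \<in> words X. reduced w},
                   monoid.mult = (\<lambda>u v. reduce (u @ v)), one = []\<rparr>"

definition gen :: "'a \<Rightarrow> 'a word" where
  "gen x = [(x, False)]"

definition normal_closure :: "('g, 'm) monoid_scheme \<Rightarrow> 'g set \<Rightarrow> 'g set" where
  "normal_closure G S =
     generate G {g \<otimes>\<^bsub>G\<^esub> s \<otimes>\<^bsub>G\<^esub> inv\<^bsub>G\<^esub> g | g s. g \<in> carrier G \<and> s \<in> S}"

definition presented_group :: "'a set \<Rightarrow> 'a word set \<Rightarrow> 'a word set monoid" where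
  "presented_group X R = free_group X Mod normal_closure (free_group X) R"

definition element_of :: "'a set \<Rightarrow> 'a word set \<Rightarrow> 'a word \<Rightarrow> 'a word set" where
  "element_of X R w = normal_closure (free_group X) R #>\<^bsub>free_group X\<^esub> reduce w"

lemma inv_letter_inv_letter [simp]: "inv_letter (inv_letter l) = l"
  by (simp add: inv_letter_def)

lemma push_words: "l \<in> X \<times> UNIV \<Longrightarrow> w \<in> words X \<Longrightarrow> push l w \<in> words X"
  by (cases w) (auto simp: words_def)

lemma reduce_words: "w \<in> words X \<Longrightarrow> reduce w \<in> words X"
  by (induction w) (use push_words in \<open>fastforce simp: reduce_def words_def\<close>)+

lemma reduced_ConsD: "reduced (l # w) \<Longrightarrow> reduced w"
  by (cases w) auto

lemma reduced_push: "reduced w \<Longrightarrow> reduced (push l w)"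
  by (cases w) (auto dest: reduced_ConsD)

lemma reduced_foldr_push: "reduced v \<Longrightarrow> reduced (foldr push u v)"
  by (induction u) (auto intro: reduced_push)

lemma reduced_reduce: "reduced (reduce w)"
  by (simp add: reduce_def reduced_foldr_push)

lemma push_reduced: "reduced (l # w) \<Longrightarrow> push l w = l # w"
  by (cases w) auto

lemma reduce_id: "reduced w \<Longrightarrow> reduce w = w"
proof (induction w)
  case (Cons l w)
  then show ?case
    using push_reduced[of l w] reduced_ConsD[of l w] by (simp add: reduce_def)
qed (simp add: reduce_def)

lemma push_push_inv: "reduced w \<Longrightarrow> push l (push (inv_letter l) w) = w"
  by (cases w) (auto simp: push_reduced)

lemma foldr_push_push:
  assumes "reduced v"
  shows "foldr push (push l u) v = push l (foldr push u v)"
proof (cases u)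
  case (Cons k w)
  then show ?thesis
    using push_push_inv[OF reduced_foldr_push[OF assms, of w], of l] by simp
qed simp

lemma foldr_push_reduce: "reduced v \<Longrightarrow> foldr push (reduce u) v = foldr push u v"
  by (induction u) (simp_all add: reduce_def foldr_push_push)

lemma reduce_append: "reduce (u @ v) = foldr push u (reduce v)"
  by (simp add: reduce_def)

lemma reduce_append_reduce1: "reduce (reduce u @ v) = reduce (u @ v)"
  by (simp add: reduce_append foldr_push_reduce reduced_reduce)

lemma reduce_append_reduce2: "reduce (u @ reduce v) = reduce (u @ v)"
  by (simp add: reduce_append reduce_id reduced_reduce)

lemma reduce_inverse: "reduce (map inv_letter (rev w) @ w) = []"
proof (induction w)
  case (Cons l w)
  have "reduce (map inv_letter (rev (l # w)) @ l # w)
      = foldr push (map inv_letter (rev w)) (push (inv_letter l) (push l (reduce w)))"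
    by (simp add: reduce_def)
  also have "push (inv_letter l) (push l (reduce w)) = reduce w"
    using push_push_inv[OF reduced_reduce, of "inv_letter l" w] by simp
  also have "foldr push (map inv_letter (rev w)) (reduce w) = []"
    using Cons by (simp add: reduce_append)
  finally show ?case .
qed (simp add: reduce_def)

lemma group_free_group: "group (free_group X)"
proof (rule groupI)
  fix u v w
  assume uvw: "u \<in> carrier (free_group X)" "v \<in> carrier (free_group X)" "w \<in> carrier (free_group X)"
  show "u \<otimes>\<^bsub>free_group X\<^esub> v \<in> carrier (free_group X)"
    using uvw reduce_words[of "u @ v" X] by (auto simp: free_group_def words_def reduced_reduce)
  show "u \<otimes>\<^bsub>free_group X\<^esub> v \<otimes>\<^bsub>free_group X\<^esub> w = u \<otimes>\<^bsub>free_group X\<^esub> (v \<otimes>\<^bsub>free_group X\<^esub> w)"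
    by (simp add: free_group_def reduce_append_reduce1 reduce_append_reduce2)
next
  show "\<one>\<^bsub>free_group X\<^esub> \<in> carrier (free_group X)"
    by (simp add: free_group_def words_def)
next
  fix u
  assume u: "u \<in> carrier (free_group X)"
  then show "\<one>\<^bsub>free_group X\<^esub> \<otimes>\<^bsub>free_group X\<^esub> u = u"
    by (simp add: free_group_def reduce_id)
  have "map inv_letter (rev u) \<in> words X"
    using u by (fastforce simp: free_group_def words_def inv_letter_def in_lists_conv_set)
  then have "reduce (map inv_letter (rev u)) \<in> carrier (free_group X)"
    by (simp add: free_group_def reduce_words reduced_reduce)
  moreover have "reduce (map inv_letter (rev u)) \<otimes>\<^bsub>free_group X\<^esub> u = \<one>\<^bsub>free_group X\<^esub>"
    by (simp add: free_group_def reduce_append_reduce1 reduce_inverse)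
  ultimately show "\<exists>y\<in>carrier (free_group X). y \<otimes>\<^bsub>free_group X\<^esub> u = \<one>\<^bsub>free_group X\<^esub>"
    by blast
qed

lemma (in group) normal_normal_closure:
  assumes "S \<subseteq> carrier G"
  shows "normal_closure G S \<lhd> G"
  unfolding normal_closure_def
proof (rule normal_generateI)
  show "{g \<otimes> s \<otimes> inv g |g s. g \<in> carrier G \<and> s \<in> S} \<subseteq> carrier G"
    using assms by auto
next
  fix h g
  assume "h \<in> {g \<otimes> s \<otimes> inv g |g s. g \<in> carrier G \<and> s \<in> S}" and g: "g \<in> carrier G"
  then obtain k s where ks: "h = k \<otimes> s \<otimes> inv k" "k \<in> carrier G" "s \<in> S" by blast
  then have "g \<otimes> h \<otimes> inv g = (g \<otimes> k) \<otimes> s \<otimes> inv (g \<otimes> k)"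
    using g assms by (auto simp: m_assoc inv_mult_group subset_iff)
  then show "g \<otimes> h \<otimes> inv g \<in> {g \<otimes> s \<otimes> inv g |g s. g \<in> carrier G \<and> s \<in> S}"
    using ks g by blast
qed

lemma group_presented_group:
  assumes "R \<subseteq> carrier (free_group X)"
  shows "group (presented_group X R)"
  unfolding presented_group_def
  by (intro normal.factorgroup_is_group group.normal_normal_closure group_free_group assms)

lemma element_of_carrier:
  assumes "w \<in> words X"
  shows "element_of X R w \<in> carrier (presented_group X R)"
  using reduce_words[OF assms] reduced_reduce[of w]
  by (auto simp: element_of_def presented_group_def FactGroup_def RCOSETS_def free_group_def)


section \<open>Recursive functions\<close>

text \<open>
  \<open>recursive_fn k f\<close>: on lists of length \<open>k\<close>, \<open>f\<close> is a total recursive function of \<open>k\<close> arguments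
  (the values on lists of other lengths are irrelevant). The class is generated from the initial
  functions by composition, primitive recursion on the first argument, and minimisation
  restricted to functions that have a zero for all values of the parameters, so that every member
  is total.
\<close>

inductive recursive_fn :: "nat \<Rightarrow> (nat list \<Rightarrow> nat) \<Rightarrow> bool" where
  zero: "recursive_fn k (\<lambda>xs. 0)"
| succ: "recursive_fn 1 (\<lambda>xs. Suc (xs ! 0))"
| proj: "i < k \<Longrightarrow> recursive_fn k (\<lambda>xs. xs ! i)"
| comp: "recursive_fn (length gs) f \<Longrightarrow> (\<And>g. g \<in> set gs \<Longrightarrow> recursive_fn k g) \<Longrightarrow>
     recursive_fn k (\<lambda>xs. f (map (\<lambda>g. g xs) gs))"
| prim_rec: "recursive_fn k f \<Longrightarrow> recursive_fn (k + 2) g \<Longrightarrow>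
     recursive_fn (k + 1) (\<lambda>xs. rec_nat (f (tl xs)) (\<lambda>m y. g (m # y # tl xs)) (hd xs))"
| mu: "recursive_fn (k + 1) f \<Longrightarrow> (\<And>xs. length xs = k \<Longrightarrow> \<exists>m. f (m # xs) = 0) \<Longrightarrow>
     recursive_fn k (\<lambda>xs. LEAST m. f (m # xs) = 0)"


section \<open>Orbit decidability\<close>

definition letter_code :: "nat letter \<Rightarrow> nat" where
  "letter_code l = 2 * fst l + of_bool (snd l)"

definition word_code :: "nat word \<Rightarrow> nat" where
  "word_code w = list_encode (map letter_code w)"

text \<open>
  Here \<open>\<langle>X | R\<rangle>\<close> is meant to be a finite presentation (with generators named by natural numbers, so
  that words can be given to an algorithm) and \<open>A\<close> a subgroup of its automorphism group.
\<close>

definition orbit_decidable ::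
    "nat set \<Rightarrow> nat word set \<Rightarrow> (nat word set \<Rightarrow> nat word set) set \<Rightarrow> bool" where
  "orbit_decidable X R A \<longleftrightarrow>
     (\<exists>f. recursive_fn 2 f \<and>
        (\<forall>u\<in>words X. \<forall>v\<in>words X.
           f [word_code u, word_code v] =
             (if \<exists>\<phi>\<in>A. \<phi> (element_of X R u) = element_of X R v then 1 else 0)))"


section \<open>The groups \<open>BS(n,1)\<close>\<close>

text \<open>The generators \<open>a\<close> and \<open>t\<close> are named \<open>0\<close> and \<open>1\<close>.\<close>

definition BS_gens :: "nat set" where
  "BS_gens = {0, 1}"

text \<open>The relation \<open>t\<^sup>-\<^sup>1 a\<^sup>n t = a\<close> as the relator \<open>t\<^sup>-\<^sup>1 a\<^sup>n t a\<^sup>-\<^sup>1\<close>, computed in the free group.\<close>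

definition BS_rels :: "int \<Rightarrow> nat word set" where
  "BS_rels n = (let F = free_group BS_gens; a = gen 0; t = gen 1
     in {inv\<^bsub>F\<^esub> t \<otimes>\<^bsub>F\<^esub> (a [^]\<^bsub>F\<^esub> n) \<otimes>\<^bsub>F\<^esub> t \<otimes>\<^bsub>F\<^esub> inv\<^bsub>F\<^esub> a})"

definition BS :: "int \<Rightarrow> nat word set monoid" where
  "BS n = presented_group BS_gens (BS_rels n)"

lemma BS_rels_subset: "BS_rels n \<subseteq> carrier (free_group BS_gens)"
proof -
  interpret group "free_group BS_gens" by (rule group_free_group)
  have "gen 0 \<in> carrier (free_group BS_gens)" "gen 1 \<in> carrier (free_group BS_gens)"
    by (auto simp: gen_def free_group_def words_def BS_gens_def)
  then show ?thesis
    by (auto simp: BS_rels_def Let_def)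
qed

lemma group_BS: "group (BS n)"
  unfolding BS_def by (rule group_presented_group[OF BS_rels_subset])

end

theory Submission
  imports Defs "HOL-Number_Theory.Number_Theory" "HOL-Algebra.Elementary_Groups"
begin

text \<open>
  In any group with elements satisfying \<open>t a = a\<^sup>n t\<close>, every word in \<open>a\<close> and \<open>t\<close> can be rewritten
  letter by letter into the form \<open>t\<^sup>-\<^sup>i a\<^sup>x t\<^sup>j\<close>. Hence, for \<open>n \<noteq> 0\<close>, \<open>BS(n,1)\<close> is the semidirect product
  \<open>\<int>[1/n] \<rtimes> \<int>\<close> with \<open>t\<close> acting as multiplication by \<open>n\<close>, and the word above represents \<open>(x/n\<^sup>i, j - i)\<close>.
  For \<open>n \<noteq> 0, 1\<close> the automorphisms are the maps \<open>(r, k) \<mapsto> (\<alpha> r + \<beta> (n\<^sup>k - 1)/(n - 1), \<epsilon> k)\<close> with \<open>\<alpha>\<close> a unit of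
  \<open>\<int>[1/n]\<close>, \<open>\<beta> \<in> \<int>[1/n]\<close> and \<open>\<epsilon> = \<plusminus>1\<close>, where \<open>\<epsilon> = -1\<close> occurs only for \<open>n = -1\<close>. After clearing denominators,
  two elements \<open>(r, k)\<close> and \<open>(s, k)\<close> lie in one orbit iff \<open>\<alpha> r \<equiv> s\<close> modulo \<open>c = 1 + n + \<dots> + n\<^bsup>\<bar>k\<bar>-1\<^esup>\<close> for
  some unit \<open>\<alpha>\<close> of \<open>\<int>[1/n]\<close>. If \<open>c \<noteq> 0\<close>, then \<open>c\<close> is coprime to \<open>n\<close>, so by Euler's theorem finitely many units
  suffice; if \<open>c = 0\<close>, the condition says that \<open>r\<close> and \<open>s\<close> divide each other up to powers of \<open>n\<close>. For \<open>n = 1\<close>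
  the group is \<open>\<int>\<^sup>2\<close> and the orbits are determined by the gcd; for \<open>n = 0\<close> it is \<open>\<int>\<close>.
\<close>

section \<open>Computable functions\<close>

text \<open>
  Equality is only required on lists of length \<open>k\<close>, which makes the class closed under changes outside of them.
\<close>

definition recursive_on :: "nat \<Rightarrow> (nat list \<Rightarrow> nat) \<Rightarrow> bool" where
  "recursive_on k f \<longleftrightarrow> (\<exists>g. recursive_fn k g \<and> (\<forall>xs. length xs = k \<longrightarrow> g xs = f xs))"

lemma recursive_onI: "recursive_fn k f \<Longrightarrow> recursive_on k f"
  by (auto simp: recursive_on_def)

lemma recursive_on_cong:
  "recursive_on k f \<Longrightarrow> (\<And>xs. length xs = k \<Longrightarrow> f xs = g xs) \<Longrightarrow> recursive_on k g"
  by (auto simp: recursive_on_def)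

lemma recursive_on_proj: "i < k \<Longrightarrow> recursive_on k (\<lambda>xs. xs ! i)"
  by (intro recursive_onI recursive_fn.proj)

lemma recursive_on_comp:
  assumes f: "recursive_on (length gs) f" and gs: "\<And>g. g \<in> set gs \<Longrightarrow> recursive_on k g"
  shows "recursive_on k (\<lambda>xs. f (map (\<lambda>g. g xs) gs))"
proof -
  obtain f' where f': "recursive_fn (length gs) f'" "\<And>xs. length xs = length gs \<Longrightarrow> f' xs = f xs"
    using f by (auto simp: recursive_on_def)
  obtain c where c: "\<And>g. g \<in> set gs \<Longrightarrow> recursive_fn k (c g)"
    "\<And>g xs. g \<in> set gs \<Longrightarrow> length xs = k \<Longrightarrow> c g xs = g xs"
    using gs unfolding recursive_on_def by metis
  have "recursive_fn k (\<lambda>xs. f' (map (\<lambda>g. g xs) (map c gs)))"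
    by (rule recursive_fn.comp) (use f' c in auto)
  moreover have "map (\<lambda>g. g xs) (map c gs) = map (\<lambda>g. g xs) gs" if "length xs = k" for xs
    using c(2) that by simp
  ultimately show ?thesis
    unfolding recursive_on_def
    using f'(2) by (intro exI[of _ "\<lambda>xs. f' (map (\<lambda>g. g xs) (map c gs))"]) (metis length_map)
qed

lemma recursive_on_comp1:
  assumes "recursive_on 1 f" "recursive_on k g"
  shows "recursive_on k (\<lambda>xs. f [g xs])"
  using recursive_on_comp[of "[g]" f k] assms by simp

lemma recursive_on_rec:
  assumes f: "recursive_on k f" and g: "recursive_on (k + 2) g"
  shows "recursive_on (k + 1) (\<lambda>xs. rec_nat (f (tl xs)) (\<lambda>m y. g (m # y # tl xs)) (hd xs))"
proof -
  obtain f' g' where f': "recursive_fn k f'" "\<And>xs. length xs = k \<Longrightarrow> f' xs = f xs"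
    and g': "recursive_fn (k + 2) g'" "\<And>xs. length xs = k + 2 \<Longrightarrow> g' xs = g xs"
    using f g by (auto simp: recursive_on_def)
  have "rec_nat (f' (tl xs)) (\<lambda>m y. g' (m # y # tl xs)) (hd xs)
      = rec_nat (f (tl xs)) (\<lambda>m y. g (m # y # tl xs)) (hd xs)" if "length xs = k + 1" for xs
    using that f'(2) g'(2) by simp
  with recursive_fn.prim_rec[OF f'(1) g'(1)] show ?thesis
    unfolding recursive_on_def by (intro exI conjI) auto
qed

lemma recursive_on_mu:
  assumes f: "recursive_on (k + 1) f" and ex: "\<And>xs. length xs = k \<Longrightarrow> \<exists>m. f (m # xs) = 0"
  shows "recursive_on k (\<lambda>xs. LEAST m. f (m # xs) = 0)"
proof -
  obtain f' where f': "recursive_fn (k + 1) f'" "\<And>xs. length xs = k + 1 \<Longrightarrow> f' xs = f xs"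
    using f by (auto simp: recursive_on_def)
  have "recursive_fn k (\<lambda>xs. LEAST m. f' (m # xs) = 0)"
    using f' ex by (intro recursive_fn.mu) auto
  moreover have "(LEAST m. f' (m # xs) = 0) = (LEAST m. f (m # xs) = 0)" if "length xs = k" for xs
    using f'(2) that by simp
  ultimately show ?thesis
    unfolding recursive_on_def by blast
qed

section \<open>Closure of the recursive functions under elementary arithmetic\<close>

lemma recursive_on_const: "recursive_on k (\<lambda>xs. c)"
proof (induction c)
  case 0
  show ?case by (intro recursive_onI recursive_fn.zero)
next
  case (Suc c)
  then show ?case
    using recursive_on_comp1[OF recursive_onI[OF recursive_fn.succ], of k "\<lambda>xs. c"] by simp
qed

lemma recursive_on_Suc: "recursive_on k f \<Longrightarrow> recursive_on k (\<lambda>xs. Suc (f xs))"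
  using recursive_on_comp1[OF recursive_onI[OF recursive_fn.succ], of k f] by simp

text \<open>The recursion schema is composed with \<open>h\<close> followed by all projections. This
  frees the recursion depth from being the first argument and passes the parameters
  \<open>xs\<close> on unchanged.\<close>

lemma recursive_on_rec_nat:
  assumes b: "recursive_on k b" and g: "recursive_on (k + 2) g" and h: "recursive_on k h"
  shows "recursive_on k (\<lambda>xs. rec_nat (b xs) (\<lambda>m y. g (m # y # xs)) (h xs))"
proof -
  define ps where "ps = h # map (\<lambda>i xs. xs ! i) [0..<k]"
  have ps: "map (\<lambda>p. p xs) ps = h xs # xs" if "length xs = k" for xs
    using that by (auto simp: ps_def comp_def intro: nth_equalityI)
  have "recursive_on k p" if "p \<in> set ps" for p
    using that h by (auto simp: ps_def intro: recursive_on_proj)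
  moreover have "length ps = k + 1" by (simp add: ps_def)
  ultimately have "recursive_on k (\<lambda>xs. (\<lambda>ys. rec_nat (b (tl ys)) (\<lambda>m y. g (m # y # tl ys)) (hd ys))
      (map (\<lambda>p. p xs) ps))"
    using recursive_on_rec[OF b g] by (intro recursive_on_comp) auto
  then show ?thesis
    by (rule recursive_on_cong) (simp add: ps)
qed

lemma recursive_on_add:
  assumes "recursive_on k f" "recursive_on k g"
  shows "recursive_on k (\<lambda>xs. f xs + g xs)"
proof -
  have "recursive_on k (\<lambda>xs. rec_nat (f xs) (\<lambda>m y. Suc ((m # y # xs) ! 1)) (g xs))"
    by (intro recursive_on_rec_nat assms recursive_on_Suc recursive_on_proj) simp
  moreover have "rec_nat a (\<lambda>m y. Suc ((m # y # xs) ! 1)) c = a + c" for a c :: nat and xs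
    by (induction c) auto
  ultimately show ?thesis by simp
qed

lemma recursive_on_diff:
  assumes "recursive_on k f" "recursive_on k g"
  shows "recursive_on k (\<lambda>xs. f xs - g xs)"
proof -
  \<comment> \<open>The predecessor is a recursion that drops the previous value and returns the
    counter; truncated subtraction then iterates it.\<close>
  have pred: "recursive_on j (\<lambda>xs. h xs - 1)" if "recursive_on j h" for j h
  proof -
    have "recursive_on j (\<lambda>xs. rec_nat 0 (\<lambda>m y. (m # y # xs) ! 0) (h xs))"
      by (intro recursive_on_rec_nat recursive_on_const that recursive_on_proj) simp
    moreover have "rec_nat 0 (\<lambda>m y. (m # y # xs) ! 0) c = c - 1" for c :: nat and xs
      by (cases c) auto
    ultimately show ?thesis by simp
  qed
  have "recursive_on k (\<lambda>xs. rec_nat (f xs) (\<lambda>m y. (m # y # xs) ! 1 - 1) (g xs))"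
    by (intro recursive_on_rec_nat assms pred recursive_on_proj) simp
  moreover have "rec_nat a (\<lambda>m y. (m # y # xs) ! 1 - 1) c = a - c" for a c :: nat and xs
    by (induction c) auto
  ultimately show ?thesis by simp
qed

section \<open>Cantor pairing and its inverse\<close>

lemma recursive_on_triangle:
  assumes "recursive_on k f"
  shows "recursive_on k (\<lambda>xs. triangle (f xs))"
proof -
  have "recursive_on k (\<lambda>xs. rec_nat 0 (\<lambda>m y. (m # y # xs) ! 1 + Suc ((m # y # xs) ! 0)) (f xs))"
    by (intro recursive_on_rec_nat assms recursive_on_const recursive_on_add recursive_on_Suc
        recursive_on_proj) simp_all
  moreover have "rec_nat 0 (\<lambda>m y. (m # y # xs) ! 1 + Suc ((m # y # xs) ! 0)) c = triangle c"
    for c :: nat and xs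
    by (induction c) auto
  ultimately show ?thesis by simp
qed

lemma triangle_mono: "m \<le> n \<Longrightarrow> triangle m \<le> triangle n"
  by (induction rule: dec_induct) auto

text \<open>The code of \<open>(x, y)\<close> is \<open>triangle (x + y) + x\<close>, which lies
  below \<open>triangle (Suc (x + y))\<close>. Hence the diagonal \<open>x + y\<close> is the least
  \<open>m\<close> with \<open>c < triangle (Suc m)\<close>; truncated subtraction expresses this
  strict inequality as an equation with 0.\<close>

lemma prod_encode_diagonal:
  "(LEAST m. Suc (prod_encode (x, y)) - triangle (Suc m) = 0) = x + y"
proof (rule Least_equality)
  show "Suc (prod_encode (x, y)) - triangle (Suc (x + y)) = 0"
    by (simp add: prod_encode_def)
next
  fix m assume "Suc (prod_encode (x, y)) - triangle (Suc m) = 0"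
  then have "triangle (x + y) < triangle (Suc m)"
    by (simp add: prod_encode_def)
  then show "x + y \<le> m"
    using triangle_mono[of "Suc m" "x + y"] by (meson not_less not_less_eq_eq)
qed

text \<open>This is the one use of minimisation. The search always stops, since \<open>m = c\<close>
  works: \<open>Suc c \<le> triangle (Suc c)\<close>.\<close>

lemma recursive_on_diagonal: "recursive_on 1 (\<lambda>xs. LEAST m. Suc (xs ! 0) - triangle (Suc m) = 0)"
proof -
  have "recursive_on (1 + 1) (\<lambda>xs. Suc (xs ! 1) - triangle (Suc (xs ! 0)))"
    by (intro recursive_on_diff recursive_on_triangle recursive_on_Suc recursive_on_proj) simp_all
  then have "recursive_on 1 (\<lambda>xs. LEAST m. Suc ((m # xs) ! 1) - triangle (Suc ((m # xs) ! 0)) = 0)"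
  proof (rule recursive_on_mu)
    fix xs :: "nat list"
    have "m \<le> triangle m" for m by (induction m) auto
    from this[of "Suc (xs ! 0)"]
    show "\<exists>m. Suc ((m # xs) ! 1) - triangle (Suc ((m # xs) ! 0)) = 0"
      by (intro exI[of _ "xs ! 0"]) simp
  qed
  then show ?thesis by simp
qed

lemma recursive_on_fst:
  assumes f: "recursive_on k f"
  shows "recursive_on k (\<lambda>xs. fst (prod_decode (f xs)))"
proof -
  define d where "d c = (LEAST m. Suc c - triangle (Suc m) = 0)" for c
  have d: "recursive_on k (\<lambda>xs. d (f xs))"
    using recursive_on_comp1[OF recursive_on_diagonal f] by (simp add: d_def)
  \<comment> \<open>With the diagonal known, the first component is the offset within it; the second
    component is then the diagonal minus the first.\<close>
  have "fst (prod_decode c) = c - triangle (d c)" for c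
    using prod_encode_diagonal[of "fst (prod_decode c)" "snd (prod_decode c)"]
    prod_decode_inverse[of c]
    by (simp add: d_def prod_encode_def split_beta)
  then show ?thesis
    by (simp add: recursive_on_diff recursive_on_triangle f d)
qed

lemma recursive_on_snd:
  assumes f: "recursive_on k f"
  shows "recursive_on k (\<lambda>xs. snd (prod_decode (f xs)))"
proof -
  define d where "d c = (LEAST m. Suc c - triangle (Suc m) = 0)" for c
  have d: "recursive_on k (\<lambda>xs. d (f xs))"
    using recursive_on_comp1[OF recursive_on_diagonal f] by (simp add: d_def)
  have "snd (prod_decode c) = d c - fst (prod_decode c)" for c
    using prod_encode_diagonal[of "fst (prod_decode c)" "snd (prod_decode c)"]
    by (simp add: d_def)
  then show ?thesis
    by (simp add: recursive_on_diff recursive_on_fst f d)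
qed

lemma recursive_on_prod_encode:
  "recursive_on k f \<Longrightarrow> recursive_on k g \<Longrightarrow> recursive_on k (\<lambda>xs. prod_encode (f xs, g xs))"
  by (simp add: prod_encode_def recursive_on_add recursive_on_triangle)

text \<open>
  Since \<open>enc\<close> is a bijection, a function on codes never meets an argument that is not a code.
\<close>

class coded =
  fixes enc :: "'a \<Rightarrow> nat"
  assumes bij_enc: "bij enc"
begin

definition dec :: "nat \<Rightarrow> 'a" where "dec = inv_into UNIV enc"

lemma dec_enc [simp]: "dec (enc x) = x"
  by (simp add: dec_def bij_enc bij_is_inj)

lemma enc_dec [simp]: "enc (dec c) = c"
  by (simp add: dec_def bij_enc bij_is_surj surj_f_inv_f)

end

instantiation nat :: coded
begin
definition enc_nat :: "nat \<Rightarrow> nat" where [simp]: "enc_nat n = n"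
instance by standard (simp add: enc_nat_def[abs_def] bij_betw_def)
end

instantiation int :: coded
begin
definition enc_int :: "int \<Rightarrow> nat" where "enc_int = int_encode"
instance by standard (simp add: enc_int_def bij_int_encode)
end

instantiation prod :: (coded, coded) coded
begin
definition enc_prod :: "'a \<times> 'b \<Rightarrow> nat" where "enc_prod p = prod_encode (map_prod enc enc p)"
instance
proof
  have "enc = prod_encode \<circ> (map_prod enc enc :: 'a \<times> 'b \<Rightarrow> _)"
    by (rule ext) (simp only: enc_prod_def comp_apply)
  moreover have "bij (map_prod enc enc :: 'a \<times> 'b \<Rightarrow> nat \<times> nat)"
    using bij_enc[where ?'a = 'a] bij_enc[where ?'a = 'b]
    by (auto intro!: prod.inj_map map_prod_surj simp: bij_def)
  ultimately show "bij (enc :: 'a \<times> 'b \<Rightarrow> nat)"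
    by (metis bij_comp bij_prod_encode)
qed
end

lemma dec_nat [simp]: "dec n = (n :: nat)"
  using enc_dec[of n, where ?'a = nat] by simp

lemma enc_Pair: "enc (x, y) = prod_encode (enc x, enc y)"
  by (simp add: enc_prod_def)

lemma dec_prod: "dec c = (dec (fst (prod_decode c)), dec (snd (prod_decode c)))"
  using dec_enc[of "(dec (fst (prod_decode c)), dec (snd (prod_decode c)))"] by (simp add: enc_Pair)

section \<open>Computability and decidability over coded types\<close>

definition computable :: "('a :: coded \<Rightarrow> 'b :: coded) \<Rightarrow> bool" where
  "computable f \<longleftrightarrow> recursive_on 1 (\<lambda>xs. enc (f (dec (xs ! 0))))"

definition decidable :: "('a :: coded \<Rightarrow> bool) \<Rightarrow> bool" where
  "decidable P \<longleftrightarrow> computable (\<lambda>x. of_bool (P x) :: nat)"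

lemma recursive_on_computable:
  "computable f \<Longrightarrow> recursive_on k g \<Longrightarrow> recursive_on k (\<lambda>xs. enc (f (dec (g xs))))"
  unfolding computable_def by (drule (1) recursive_on_comp1) simp

lemma computable_const: "computable (\<lambda>x. c)"
  by (simp add: computable_def recursive_on_const)

lemma computable_ident: "computable (\<lambda>x. x)"
  by (simp add: computable_def recursive_on_proj)

lemma computable_comp: "computable f \<Longrightarrow> computable g \<Longrightarrow> computable (\<lambda>x. f (g x))"
  unfolding computable_def by (drule (1) recursive_on_comp1) simp

lemma computable_Pair: "computable f \<Longrightarrow> computable g \<Longrightarrow> computable (\<lambda>x. (f x, g x))"
  by (simp add: computable_def enc_Pair recursive_on_prod_encode)

lemma computable_fst:
  assumes "computable f"
  shows "computable (\<lambda>x. fst (f x))"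
proof -
  have "computable (fst :: 'b \<times> 'c \<Rightarrow> _)"
    unfolding computable_def dec_prod by (simp add: recursive_on_fst recursive_on_proj)
  from computable_comp[OF this assms] show ?thesis .
qed

lemma computable_snd:
  assumes "computable f"
  shows "computable (\<lambda>x. snd (f x))"
proof -
  have "computable (snd :: 'b \<times> 'c \<Rightarrow> _)"
    unfolding computable_def dec_prod by (simp add: recursive_on_snd recursive_on_proj)
  from computable_comp[OF this assms] show ?thesis .
qed

named_theorems computable_intros

lemmas [computable_intros] =
  computable_const computable_ident computable_Pair computable_fst computable_snd

lemma computable_Suc [computable_intros]: "computable f \<Longrightarrow> computable (\<lambda>x. Suc (f x))"
  by (simp add: computable_def recursive_on_Suc)

lemma computable_add_nat [computable_intros]:
  "computable f \<Longrightarrow> computable g \<Longrightarrow> computable (\<lambda>x. f x + g x :: nat)"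
  by (simp add: computable_def recursive_on_add)

lemma computable_diff_nat [computable_intros]:
  "computable f \<Longrightarrow> computable g \<Longrightarrow> computable (\<lambda>x. f x - g x :: nat)"
  by (simp add: computable_def recursive_on_diff)

text \<open>Values of an arbitrary coded type can be carried through the recursion: the step is
  conjugated with \<open>enc\<close> and \<open>dec\<close>, and by induction every stage is the
  code of the intended value.\<close>

lemma computable_rec_nat:
  assumes b: "computable b" and h: "computable h"
    and g: "computable (\<lambda>z. g (fst z) (fst (snd z)) (snd (snd z)))"
  shows "computable (\<lambda>x. rec_nat (b x) (g x) (h x))"
proof -
  \<comment> \<open>The recursion supplies its arguments as counter, previous value, parameter,
    whereas \<open>g\<close> takes the parameter first.\<close>
  have "recursive_on (1 + 2) (\<lambda>xs. enc ((\<lambda>z. g (fst z) (fst (snd z)) (snd (snd z)))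
      (dec (prod_encode (xs ! 2, prod_encode (xs ! 0, xs ! 1))))))"
    by (intro recursive_on_computable[OF g] recursive_on_prod_encode recursive_on_proj) simp_all
  then have "recursive_on (1 + 2) (\<lambda>xs. enc (g (dec (xs ! 2)) (xs ! 0) (dec (xs ! 1))))"
    by (simp add: dec_prod)
  from recursive_on_rec_nat[OF b[unfolded computable_def] this h[unfolded computable_def]]
  have *: "recursive_on 1 (\<lambda>xs. rec_nat (enc (b (dec (xs ! 0))))
      (\<lambda>m y. enc (g (dec (xs ! 0)) m (dec y))) (h (dec (xs ! 0))))"
    by simp
  have "rec_nat (enc (b x)) (\<lambda>m y. enc (g x m (dec y))) k = enc (rec_nat (b x) (g x) k)" for x k
    by (induction k) auto
  with * show ?thesis by (simp add: computable_def)
qed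

lemma computable_mult_nat [computable_intros]:
  assumes "computable f" "computable g"
  shows "computable (\<lambda>x. f x * g x :: nat)"
proof -
  have "computable (\<lambda>x. rec_nat 0 (\<lambda>m y. y + g x) (f x))"
    by (intro computable_rec_nat computable_intros assms computable_comp[OF assms(2)])
  moreover have "rec_nat 0 (\<lambda>m y. y + a) k = k * a" for a k :: nat
    by (induction k) auto
  ultimately show ?thesis by simp
qed

lemma computable_div_2 [computable_intros]:
  assumes "computable f"
  shows "computable (\<lambda>x. f x div 2 :: nat)"
proof -
  \<comment> \<open>Halving satisfies \<open>Suc m div 2 = m - m div 2\<close>, which is a recursion
    without case distinction.\<close>
  have "computable (\<lambda>x. rec_nat 0 (\<lambda>m y. m - y) (f x))"
    by (intro computable_rec_nat computable_intros assms)
  moreover have "rec_nat 0 (\<lambda>m y. m - y) k = k div 2" for k :: nat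
    by (induction k) auto
  ultimately show ?thesis by simp
qed

lemma decidable_eq_0:
  assumes "computable f"
  shows "decidable (\<lambda>x. f x = (0 :: nat))"
proof -
  have "of_bool (f x = 0) = 1 - f x" for x
    by (simp add: of_bool_def)
  then show ?thesis
    unfolding decidable_def by (simp add: computable_intros assms)
qed

lemma decidable_not [computable_intros]: "decidable P \<Longrightarrow> decidable (\<lambda>x. \<not> P x)"
  using decidable_eq_0 by (fastforce simp: decidable_def)

lemma decidable_conj [computable_intros]:
  "decidable P \<Longrightarrow> decidable Q \<Longrightarrow> decidable (\<lambda>x. P x \<and> Q x)"
  by (simp add: decidable_def of_bool_conj computable_mult_nat)

lemma decidable_disj [computable_intros]:
  assumes "decidable P" "decidable Q"
  shows "decidable (\<lambda>x. P x \<or> Q x)"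
  using decidable_not[OF decidable_conj[OF decidable_not decidable_not], OF assms] by simp

lemma decidable_imp [computable_intros]:
  assumes "decidable P" "decidable Q"
  shows "decidable (\<lambda>x. P x \<longrightarrow> Q x)"
  unfolding imp_conv_disj by (intro decidable_disj decidable_not assms)

lemma decidable_iff [computable_intros]:
  assumes "decidable P" "decidable Q"
  shows "decidable (\<lambda>x. P x \<longleftrightarrow> Q x)"
  unfolding iff_conv_conj_imp by (intro decidable_conj decidable_imp assms)

lemma decidable_const [computable_intros]: "decidable (\<lambda>x. P)"
  by (simp add: decidable_def computable_intros)

lemma decidable_le [computable_intros]:
  "computable f \<Longrightarrow> computable g \<Longrightarrow> decidable (\<lambda>x. f x \<le> (g x :: nat))"
  using decidable_eq_0[of "\<lambda>x. f x - g x"] by (simp add: computable_intros)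

lemma decidable_eq_nat [computable_intros]:
  "computable f \<Longrightarrow> computable g \<Longrightarrow> decidable (\<lambda>x. f x = (g x :: nat))"
  unfolding eq_iff by (intro computable_intros)

lemma decidable_comp: "decidable P \<Longrightarrow> computable g \<Longrightarrow> decidable (\<lambda>x. P (g x))"
  unfolding decidable_def by (rule computable_comp[of "\<lambda>x. of_bool (P x)"])

lemma computable_if [computable_intros]:
  assumes "decidable P" "computable f" "computable g"
  shows "computable (\<lambda>x. if P x then f x else g x)"
proof -
  \<comment> \<open>A recursion of depth 0 or 1 selects the branch.\<close>
  have "computable (\<lambda>x. rec_nat (g x) (\<lambda>m y. f x) (of_bool (P x)))"
    by (intro computable_rec_nat assms[unfolded decidable_def] computable_comp[OF assms(2)] computable_intros)
  moreover have "rec_nat (g x) (\<lambda>m y. f x) (of_bool (P x)) = (if P x then f x else g x)" for x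
    by simp
  ultimately show ?thesis by simp
qed

lemma decidable_bex [computable_intros]:
  assumes P: "decidable (\<lambda>z. P (fst z) (snd z))" and h: "computable h"
  shows "decidable (\<lambda>x. \<exists>i<(h x :: nat). P x i)"
proof -
  have "computable (\<lambda>x. rec_nat 0 (\<lambda>m y. if P x m then 1 else y) (h x) :: nat)"
    by (intro computable_rec_nat computable_intros h
        decidable_comp[OF P, of "\<lambda>z. (fst z, fst (snd z))", simplified])
  moreover have "rec_nat 0 (\<lambda>m y. if P x m then 1 else y) k = (of_bool (\<exists>i<k. P x i) :: nat)" for x k
    by (induction k) (auto simp: less_Suc_eq)
  ultimately show ?thesis by (simp add: decidable_def)
qed

lemma decidable_ball [computable_intros]:
  assumes P: "decidable (\<lambda>z. P (fst z) (snd z))" and h: "computable h"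
  shows "decidable (\<lambda>x. \<forall>i<(h x :: nat). P x i)"
proof -
  have "decidable (\<lambda>x. \<not> (\<exists>i<h x. \<not> P x i))"
    by (intro decidable_bex computable_intros assms)
  then show ?thesis by simp
qed

lemma decidable_dvd_nat [computable_intros]:
  assumes "computable f" "computable g"
  shows "decidable (\<lambda>x. f x dvd (g x :: nat))"
proof -
  \<comment> \<open>A quotient is at most \<open>g x\<close> if \<open>f x\<close> is positive; if
    \<open>f x = 0\<close> divides \<open>g x\<close>, then \<open>g x = 0\<close> and the quotient
    0 serves.\<close>
  have "decidable (\<lambda>x. \<exists>k<Suc (g x). g x = f x * k)"
    by (intro computable_intros computable_comp[OF assms(1)] computable_comp[OF assms(2)] assms)
  moreover have "(\<exists>k<Suc (g x). g x = f x * k) \<longleftrightarrow> f x dvd g x" for x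
  proof
    assume "f x dvd g x"
    then obtain k where k: "g x = f x * k" by (elim dvdE)
    show "\<exists>k<Suc (g x). g x = f x * k"
    proof (cases "f x = 0")
      case True
      then show ?thesis using k by auto
    next
      case False
      then have "k \<le> f x * k" by simp
      then show ?thesis using k by (intro exI[of _ k]) (simp add: less_Suc_eq_le)
    qed
  qed auto
  ultimately show ?thesis by simp
qed

section \<open>Integer arithmetic on codes\<close>

lemma computable_int [computable_intros]:
  assumes "computable f"
  shows "computable (\<lambda>x. int (f x))"
proof -
  have "computable (\<lambda>x. 2 * f x)"
    by (intro computable_intros assms)
  then show ?thesis
    by (simp add: computable_def enc_int_def int_encode_def sum_encode_def)
qed

lemma computable_int_diff:
  assumes "computable f" "computable g"
  shows "computable (\<lambda>x. int (f x) - int (g x))"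
proof -
  \<comment> \<open>\<open>int_encode\<close> sends a non-negative \<open>i\<close> to
    \<open>2 * i\<close> and a negative \<open>i\<close> to
    \<open>Suc (2 * (- i - 1))\<close>.\<close>
  have "computable (\<lambda>x. if g x \<le> f x then 2 * (f x - g x) else Suc (2 * (g x - f x - 1)))"
    by (intro computable_intros assms)
  moreover have "enc (int m - int n) = (if n \<le> m then 2 * (m - n) else Suc (2 * (n - m - 1)))" for m n
    by (auto simp: enc_int_def int_encode_def sum_encode_def nat_diff_distrib
        simp flip: of_nat_diff)
  ultimately show ?thesis
    by (simp add: computable_def)
qed

lemma computable_nat [computable_intros]:
  assumes "computable f"
  shows "computable (\<lambda>x. nat (f x))"
proof -
  have "computable (\<lambda>c :: nat. if c = 2 * (c div 2) then c div 2 else 0)"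
    by (intro computable_intros)
  moreover have "nat (dec c) = (if c = 2 * (c div 2) then c div 2 else 0)" for c
  proof -
    obtain i :: int where c: "c = enc i" by (metis enc_dec)
    show ?thesis unfolding c dec_enc
      by (auto simp: enc_int_def int_encode_def sum_encode_def)
  qed
  ultimately have "computable nat"
    by (simp add: computable_def cong: if_cong)
  from computable_comp[OF this assms] show ?thesis .
qed

lemma computable_uminus_int [computable_intros]:
  assumes "computable f"
  shows "computable (\<lambda>x. - f x :: int)"
proof -
  \<comment> \<open>For \<open>i > 0\<close> the codes of \<open>i\<close> and \<open>- i\<close>
    are the neighbours \<open>2 * i\<close> and \<open>2 * i - 1\<close>, which are swapped;
    truncated subtraction keeps the code 0 fixed.\<close>
  have "computable (\<lambda>c :: nat. if c = 2 * (c div 2) then c - 1 else c + 1)"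
    by (intro computable_intros)
  moreover have "enc (- dec c :: int) = (if c = 2 * (c div 2) then c - 1 else c + 1)" for c
  proof -
    obtain i :: int where c: "c = enc i" by (metis enc_dec)
    show ?thesis unfolding c dec_enc
      by (auto simp: enc_int_def int_encode_def sum_encode_def)
  qed
  ultimately have "computable (uminus :: int \<Rightarrow> int)"
    by (simp add: computable_def cong: if_cong)
  from computable_comp[OF this assms] show ?thesis .
qed

lemma computable_add_int [computable_intros]:
  assumes "computable f" "computable g"
  shows "computable (\<lambda>x. f x + g x :: int)"
proof -
  \<comment> \<open>Each integer is split into its positive and negative part, so that natural
    number arithmetic suffices; multiplication is treated in the same way.\<close>
  have "computable (\<lambda>x. int (nat (f x) + nat (g x)) - int (nat (- f x) + nat (- g x)))"
    by (intro computable_int_diff computable_intros assms)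
  moreover have "int (nat (f x) + nat (g x)) - int (nat (- f x) + nat (- g x)) = f x + g x" for x
    by linarith
  ultimately show ?thesis by simp
qed

lemma computable_diff_int [computable_intros]:
  "computable f \<Longrightarrow> computable g \<Longrightarrow> computable (\<lambda>x. f x - g x :: int)"
  using computable_add_int[of f "\<lambda>x. - g x"] by (simp add: computable_intros)

lemma computable_mult_int [computable_intros]:
  assumes "computable f" "computable g"
  shows "computable (\<lambda>x. f x * g x :: int)"
proof -
  have "computable (\<lambda>x. int (nat (f x) * nat (g x) + nat (- f x) * nat (- g x))
      - int (nat (f x) * nat (- g x) + nat (- f x) * nat (g x)))"
    by (intro computable_int_diff computable_intros assms)
  moreover have "int (nat a * nat b + nat (- a) * nat (- b))
      - int (nat a * nat (- b) + nat (- a) * nat b) = a * b" for a b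
    by (cases "0 \<le> a"; cases "0 \<le> b") auto
  ultimately show ?thesis by simp
qed

lemma computable_nat_abs [computable_intros]:
  assumes "computable f"
  shows "computable (\<lambda>x. nat \<bar>f x\<bar>)"
proof -
  have "computable (\<lambda>x. nat (f x) + nat (- f x))"
    by (intro computable_intros assms)
  moreover have "nat (f x) + nat (- f x) = nat \<bar>f x\<bar>" for x by linarith
  ultimately show ?thesis by simp
qed

lemma decidable_dvd_int [computable_intros]:
  assumes "computable f" "computable g"
  shows "decidable (\<lambda>x. f x dvd (g x :: int))"
proof -
  have "decidable (\<lambda>x. nat \<bar>f x\<bar> dvd nat \<bar>g x\<bar>)"
    by (intro computable_intros assms)
  then show ?thesis by (simp add: nat_abs_dvd_iff)
qed

lemma decidable_eq_int [computable_intros]: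
  assumes "computable f" "computable g"
  shows "decidable (\<lambda>x. f x = (g x :: int))"
proof -
  have "decidable (\<lambda>x. nat (f x) = nat (g x) \<and> nat (- f x) = nat (- g x))"
    by (intro computable_intros assms)
  moreover have "nat (f x) = nat (g x) \<and> nat (- f x) = nat (- g x) \<longleftrightarrow> f x = g x" for x
    by linarith
  ultimately show ?thesis by simp
qed

lemma computable_power_int [computable_intros]:
  assumes "computable f" "computable g"
  shows "computable (\<lambda>x. f x ^ g x :: int)"
proof -
  have "computable (\<lambda>x. rec_nat 1 (\<lambda>m y. y * f x) (g x))"
    by (intro computable_rec_nat computable_intros assms computable_comp[OF assms(1)])
  moreover have "rec_nat 1 (\<lambda>m y. y * a) k = a ^ k" for a :: int and k
    by (induction k) auto
  ultimately show ?thesis by simp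
qed

lemma computable_sum_int:
  assumes "computable (\<lambda>z. f (fst z) (snd z))" "computable h"
  shows "computable (\<lambda>x. \<Sum>i<(h x :: nat). f x i :: int)"
proof -
  have "computable (\<lambda>x. rec_nat 0 (\<lambda>m y. y + f x m) (h x))"
    by (intro computable_rec_nat computable_intros assms
        computable_comp[OF assms(1), of "\<lambda>z. (fst z, fst (snd z))", simplified])
  moreover have "rec_nat 0 (\<lambda>m y. y + f x m) k = (\<Sum>i<k. f x i)" for x k
    by (induction k) auto
  ultimately show ?thesis by simp
qed

text \<open>The fold is a recursion on pairs of a remaining list code and an accumulator. The code
  of the list itself serves as the number of rounds: it is at least the length of the list, and a
  round on the empty list changes nothing.\<close>

lemma computable_fold:
  assumes g: "computable (\<lambda>z. g (fst z) (snd z))" and s: "computable s" and h: "computable h"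
  shows "computable (\<lambda>x. fold g (list_decode (h x)) (s x))"
proof -
  \<comment> \<open>Code 0 is the empty list, and \<open>Suc (prod_encode (x, c))\<close> is the
    list with head \<open>x\<close> and tail code \<open>c\<close>.\<close>
  define step where "step = (\<lambda>(c, y). if c = 0 then (c, y)
    else (snd (prod_decode (c - 1)), g (fst (prod_decode (c - 1))) y))"
  have "enc p = prod_encode p" for p :: "nat \<times> nat"
    by (cases p) (simp add: enc_Pair)
  then have pd: "computable prod_decode"
    by (simp add: computable_def recursive_on_proj)
  have "computable (\<lambda>z. (fst (prod_decode (fst z - 1)), snd z))"
    by (intro computable_intros computable_comp[OF pd])
  from computable_comp[OF g this]
  have "computable (\<lambda>z. if fst z = 0 then (fst z, snd z)
    else (snd (prod_decode (fst z - 1)), g (fst (prod_decode (fst z - 1))) (snd z)))"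
    by (intro computable_intros computable_comp[OF pd]) simp_all
  then have step: "computable step"
    by (simp add: step_def split_beta')
  have "computable (\<lambda>x. snd (rec_nat (h x, s x) (\<lambda>m y. step y) (h x)))"
    by (intro computable_intros computable_rec_nat computable_comp[OF step] h s)
  moreover have rec: "rec_nat (list_encode xs, y) (\<lambda>m y. step y) k
      = (list_encode (drop k xs), fold g (take k xs) y)" for xs y k
  proof (induction k)
    case (Suc k)
    show ?case
    proof (cases "k < length xs")
      case True
      with Suc show ?thesis
        by (simp add: step_def take_Suc_conv_app_nth Cons_nth_drop_Suc[symmetric])
    qed (use Suc in \<open>simp add: step_def\<close>)
  qed simp
  moreover have "snd (rec_nat (c, y) (\<lambda>m y. step y) c) = fold g (list_decode c) y" for c y
  proof -
    have "length xs \<le> list_encode xs" for xs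
      by (induction xs) (auto intro: le_trans[OF _ le_prod_encode_2])
    from this[of "list_decode c"] show ?thesis
      using rec[of "list_decode c" y c] by simp
  qed
  ultimately show ?thesis by simp
qed

text \<open>This returns from predicates on coded pairs to an honest member of
  \<open>recursive_fn\<close>, in the form that \<open>orbit_decidable\<close> asks for.\<close>

lemma recursive_fn_decidable:
  assumes "decidable P"
  obtains f where "recursive_fn 2 f" "\<And>x y :: nat. f [x, y] = (if P (x, y) then 1 else 0)"
proof -
  have "recursive_on 2 (\<lambda>xs. enc (of_bool (P (dec (prod_encode (xs ! 0, xs ! 1)))) :: nat))"
    by (intro recursive_on_computable[of "\<lambda>x. of_bool (P x)"] assms[unfolded decidable_def]
        recursive_on_prod_encode recursive_on_proj) simp_all
  then obtain f where f: "recursive_fn 2 f"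
    "\<And>xs. length xs = 2 \<Longrightarrow> f xs = of_bool (P (xs ! 0, xs ! 1))"
    by (auto simp: recursive_on_def dec_prod)
  show thesis
    by (rule that[OF f(1)]) (simp add: f(2))
qed

section \<open>Words and presented groups\<close>

definition letter_val :: "('g, 'm) monoid_scheme \<Rightarrow> ('a \<Rightarrow> 'g) \<Rightarrow> 'a letter \<Rightarrow> 'g" where
  "letter_val K h l = (if snd l then inv\<^bsub>K\<^esub> h (fst l) else h (fst l))"

definition word_val :: "('g, 'm) monoid_scheme \<Rightarrow> ('a \<Rightarrow> 'g) \<Rightarrow> 'a word \<Rightarrow> 'g" where
  "word_val K h w = foldr (\<lambda>l y. letter_val K h l \<otimes>\<^bsub>K\<^esub> y) w \<one>\<^bsub>K\<^esub>"

context group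
begin

lemma letter_val_closed: "h \<in> X \<rightarrow> carrier G \<Longrightarrow> l \<in> X \<times> UNIV \<Longrightarrow> letter_val G h l \<in> carrier G"
  by (auto simp: letter_val_def)

lemma letter_val_inv_letter:
  "h \<in> X \<rightarrow> carrier G \<Longrightarrow> l \<in> X \<times> UNIV \<Longrightarrow> letter_val G h (inv_letter l) = inv letter_val G h l"
  by (auto simp: letter_val_def inv_letter_def Pi_iff)

lemma word_val_closed:
  assumes "h \<in> X \<rightarrow> carrier G" "w \<in> words X"
  shows "word_val G h w \<in> carrier G"
  using assms(2) letter_val_closed[OF assms(1)] unfolding words_def
  by (induction w) (auto simp: word_val_def)

lemma word_val_append:
  assumes h: "h \<in> X \<rightarrow> carrier G" and "u \<in> words X" "v \<in> words X"
  shows "word_val G h (u @ v) = word_val G h u \<otimes> word_val G h v"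
  using assms(2)
proof (induction u)
  case Nil
  then show ?case using word_val_closed[OF h assms(3)] by (simp add: word_val_def)
next
  case (Cons l u)
  then have l: "l \<in> X \<times> UNIV" and u: "u \<in> words X" by (auto simp: words_def)
  have "word_val G h ((l # u) @ v) = letter_val G h l \<otimes> (word_val G h u \<otimes> word_val G h v)"
    using Cons.IH[OF u] by (simp add: word_val_def)
  also have "\<dots> = (letter_val G h l \<otimes> word_val G h u) \<otimes> word_val G h v"
    using letter_val_closed[OF h l] word_val_closed[OF h] u assms(3) by (simp add: m_assoc)
  finally show ?case by (simp add: word_val_def)
qed

lemma word_val_push:
  assumes h: "h \<in> X \<rightarrow> carrier G" and l: "l \<in> X \<times> UNIV" and w: "w \<in> words X"
  shows "word_val G h (push l w) = letter_val G h l \<otimes> word_val G h w"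
proof (cases w)
  case (Cons k w')
  then have w': "w' \<in> words X" using w by (auto simp: words_def)
  show ?thesis
  proof (cases "k = inv_letter l")
    case True
    then have "letter_val G h l \<otimes> word_val G h w
        = letter_val G h l \<otimes> (inv letter_val G h l \<otimes> word_val G h w')"
      using Cons letter_val_inv_letter[OF h l] by (simp add: word_val_def)
    also have "\<dots> = word_val G h w'"
      using letter_val_closed[OF h l] word_val_closed[OF h w'] by (simp flip: m_assoc)
    finally show ?thesis using Cons True by simp
  qed (use Cons in \<open>simp add: word_val_def\<close>)
qed (simp add: word_val_def)

lemma word_val_reduce:
  assumes h: "h \<in> X \<rightarrow> carrier G" and "w \<in> words X"
  shows "word_val G h (reduce w) = word_val G h w"
  using assms(2)
proof (induction w)
  case (Cons l w)
  then have l: "l \<in> X \<times> UNIV" and w: "w \<in> words X" by (auto simp: words_def)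
  have "word_val G h (reduce (l # w)) = letter_val G h l \<otimes> word_val G h (reduce w)"
    using word_val_push[OF h l reduce_words[OF w]] by (simp add: reduce_def)
  then show ?case using Cons.IH[OF w] by (simp add: word_val_def)
qed (simp add: reduce_def)

lemma word_val_hom:
  assumes h: "h \<in> X \<rightarrow> carrier G"
  shows "word_val G h \<in> hom (free_group X) G"
proof (rule homI)
  fix u v assume "u \<in> carrier (free_group X)" "v \<in> carrier (free_group X)"
  then have uv: "u \<in> words X" "v \<in> words X" by (auto simp: free_group_def)
  then have "u @ v \<in> words X" by (auto simp: words_def)
  then show "word_val G h (u \<otimes>\<^bsub>free_group X\<^esub> v) = word_val G h u \<otimes> word_val G h v"
    using word_val_reduce[OF h] word_val_append[OF h uv] by (simp add: free_group_def)
qed (use word_val_closed[OF h] in \<open>auto simp: free_group_def\<close>)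

text \<open>A trivial relator becomes a rule for moving \<open>t\<close> to the right past
  \<open>a\<close>.\<close>

lemma conjugate_relation:
  assumes "a \<in> carrier G" "t \<in> carrier G" "x \<in> carrier G" "inv t \<otimes> x \<otimes> t \<otimes> inv a = \<one>"
  shows "t \<otimes> a = x \<otimes> t"
proof -
  have "inv t \<otimes> x \<otimes> t = a"
    using assms inv_solve_right[of "\<one>" "inv t \<otimes> x \<otimes> t" a] by simp
  then have "t \<otimes> a = t \<otimes> (inv t \<otimes> x \<otimes> t)" by simp
  also have "\<dots> = (t \<otimes> inv t) \<otimes> (x \<otimes> t)" using assms by (simp only: m_assoc inv_closed m_closed)
  finally show ?thesis using assms by simp
qed

lemma normal_closure_subset:
  assumes "H \<lhd> G" "S \<subseteq> H"
  shows "normal_closure G S \<subseteq> H"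
proof -
  interpret H: normal H G by (rule assms(1))
  have "{g \<otimes> s \<otimes> inv g |g s. g \<in> carrier G \<and> s \<in> S} \<subseteq> H"
    using assms(2) H.inv_op_closed2 by blast
  then show ?thesis
    unfolding normal_closure_def by (rule generate_subgroup_incl[OF _ H.subgroup_axioms])
qed

end

lemma gen_carrier: "x \<in> X \<Longrightarrow> gen x \<in> carrier (free_group X)"
  by (auto simp: gen_def free_group_def words_def)

lemma reduce_carrier: "w \<in> words X \<Longrightarrow> reduce w \<in> carrier (free_group X)"
  by (simp add: free_group_def reduce_words reduced_reduce)

lemma element_of_hom:
  assumes "R \<subseteq> carrier (free_group X)"
  shows "element_of X R \<in> hom (free_group X) (presented_group X R)"
proof -
  interpret normal "normal_closure (free_group X) R" "free_group X"
    by (intro group.normal_normal_closure group_free_group assms)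
  have "element_of X R w = normal_closure (free_group X) R #>\<^bsub>free_group X\<^esub> w"
    if "w \<in> carrier (free_group X)" for w
    using that by (simp add: element_of_def free_group_def reduce_id)
  then show ?thesis
    using r_coset_hom_Mod hom_restrict unfolding presented_group_def by blast
qed

lemma element_of_eq_one:
  assumes "R \<subseteq> carrier (free_group X)" "w \<in> carrier (free_group X)"
  shows "element_of X R w = \<one>\<^bsub>presented_group X R\<^esub> \<longleftrightarrow> w \<in> normal_closure (free_group X) R"
proof -
  interpret normal "normal_closure (free_group X) R" "free_group X"
    by (intro group.normal_normal_closure group_free_group assms)
  have "reduce w = w" using assms(2) by (simp add: free_group_def reduce_id)
  then show ?thesis
    using assms(2) rcos_const rcos_self subgroup_axioms
    by (auto simp: element_of_def presented_group_def)
qed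

text \<open>Because \<open>element_of\<close> is a homomorphism on the free group, classes can be
  evaluated letter by letter; rewriting proved for \<open>word_val\<close> in an arbitrary group
  thus applies to the presented group.\<close>

lemma element_of_eq_word_val:
  assumes R: "R \<subseteq> carrier (free_group X)" and "w \<in> words X"
  shows "element_of X R w = word_val (presented_group X R) (\<lambda>x. element_of X R (gen x)) w"
  using assms(2)
proof (induction w)
  case Nil
  interpret group "free_group X" by (rule group_free_group)
  have "\<one>\<^bsub>free_group X\<^esub> = []" by (simp add: free_group_def)
  then show ?case
    using hom_one[OF element_of_hom[OF R] group_free_group group_presented_group[OF R]]
    by (simp add: word_val_def)
next
  case (Cons l w)
  interpret F: group "free_group X" by (rule group_free_group)
  interpret group_hom "free_group X" "presented_group X R" "element_of X R"
    using element_of_hom[OF R] group_presented_group[OF R] group_free_group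
    by (simp add: group_hom_def group_hom_axioms_def)
  obtain x b where l: "l = (x, b)" by (cases l)
  have x: "x \<in> X" and w: "w \<in> words X" using Cons.prems by (auto simp: l words_def)
  have inv: "inv\<^bsub>free_group X\<^esub> gen x = [(x, True)]"
    by (rule F.inv_equality)
      (use x in \<open>auto simp: gen_def free_group_def words_def reduce_def inv_letter_def\<close>)
  have lw: "[l] \<in> carrier (free_group X)" "letter_val (presented_group X R) (\<lambda>x. element_of X R (gen x)) l
      = element_of X R [l]"
    using x hom_inv[OF gen_carrier[OF x]]
    by (auto simp: l letter_val_def inv, auto simp: gen_def free_group_def words_def)
  have "element_of X R (l # w) = element_of X R ([l] \<otimes>\<^bsub>free_group X\<^esub> reduce w)"
    using reduce_append_reduce2[of "[l]" w]
    by (simp add: element_of_def free_group_def reduce_id[OF reduced_reduce])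
  also have "\<dots> = element_of X R [l] \<otimes>\<^bsub>presented_group X R\<^esub> element_of X R (reduce w)"
    using lw(1) reduce_carrier[OF w] by simp
  also have "element_of X R (reduce w) = element_of X R w"
    by (simp add: element_of_def reduce_id[OF reduced_reduce])
  finally show ?case
    using Cons.IH[OF w] lw(2) by (simp add: word_val_def)
qed

text \<open>Von Dyck's theorem combined with the first isomorphism theorem: \<open>rel\<close> puts
  the normal closure into the kernel of the evaluation, \<open>ker\<close> gives the reverse
  inclusion, and \<open>surj\<close> identifies the image with \<open>K\<close>.\<close>

lemma presented_group_iso:
  assumes K: "group K" and h: "h \<in> X \<rightarrow> carrier K" and R: "R \<subseteq> carrier (free_group X)"
    and rel: "\<And>r. r \<in> R \<Longrightarrow> word_val K h r = \<one>\<^bsub>K\<^esub>"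
    and surj: "carrier K \<subseteq> word_val K h ` words X"
    and ker: "\<And>w. w \<in> words X \<Longrightarrow> word_val K h w = \<one>\<^bsub>K\<^esub> \<Longrightarrow> element_of X R w = \<one>\<^bsub>presented_group X R\<^esub>"
  obtains \<theta> where "\<theta> \<in> iso (presented_group X R) K"
    and "\<And>w. w \<in> words X \<Longrightarrow> \<theta> (element_of X R w) = word_val K h w"
proof -
  let ?F = "free_group X" and ?N = "normal_closure (free_group X) R"
  interpret K: group K by (rule K)
  interpret F: group ?F by (rule group_free_group)
  interpret group_hom ?F K "word_val K h"
    using K.word_val_hom[OF h] by unfold_locales auto
  have ker_eq: "kernel ?F K (word_val K h) = ?N"
  proof
    have "R \<subseteq> kernel ?F K (word_val K h)"
      using R rel by (auto simp: kernel_def)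
    then show "?N \<subseteq> kernel ?F K (word_val K h)"
      by (intro F.normal_closure_subset normal_kernel)
    show "kernel ?F K (word_val K h) \<subseteq> ?N"
    proof
      fix w assume "w \<in> kernel ?F K (word_val K h)"
      then have w: "w \<in> carrier ?F" "word_val K h w = \<one>\<^bsub>K\<^esub>" by (simp_all add: kernel_def)
      then have "w \<in> words X" by (simp add: free_group_def)
      then show "w \<in> ?N" using ker w element_of_eq_one[OF R w(1)] by blast
    qed
  qed
  have im: "word_val K h ` carrier ?F = carrier K"
  proof
    show "carrier K \<subseteq> word_val K h ` carrier ?F"
    proof
      fix y assume "y \<in> carrier K"
      then obtain w where w: "w \<in> words X" "y = word_val K h w" using surj by blast
      then show "y \<in> word_val K h ` carrier ?F"
        using reduce_carrier K.word_val_reduce[OF h w(1)] by (intro image_eqI[of _ _ "reduce w"]) auto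
    qed
  qed auto
  \<comment> \<open>Evaluation is constant on a coset of its kernel, so the image of a coset is a
    singleton.\<close>
  let ?\<theta> = "\<lambda>C. the_elem (word_val K h ` C)"
  show thesis
  proof
    show "?\<theta> \<in> iso (presented_group X R) K"
      unfolding presented_group_def ker_eq[symmetric] by (rule FactGroup_iso_set[OF im])
  next
    fix w assume w: "w \<in> words X"
    have "word_val K h ` (?N #>\<^bsub>?F\<^esub> reduce w) = {word_val K h (reduce w)}"
      using reduce_carrier[OF w] F.one_closed
      unfolding ker_eq[symmetric] r_coset_def
      by (force simp: kernel_def)
    then show "?\<theta> (element_of X R w) = word_val K h w"
      using K.word_val_reduce[OF h w] by (simp add: element_of_def)
  qed
qed

text \<open>Members of \<open>auto\<close> must be extensional, those of \<open>iso\<close> need not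
  be; restriction to the carrier does not affect the value at \<open>x\<close>.\<close>

lemma auto_conv_iso:
  assumes "group G" "x \<in> carrier G"
  shows "(\<exists>\<phi>\<in>auto G. \<phi> x = y) \<longleftrightarrow> (\<exists>\<phi>\<in>iso G G. \<phi> x = y)"
proof
  assume "\<exists>\<phi>\<in>iso G G. \<phi> x = y"
  then obtain \<phi> where \<phi>: "\<phi> \<in> iso G G" "\<phi> x = y" by blast
  then have "restrict \<phi> (carrier G) \<in> auto G"
    using assms(1) group.axioms(1)[OF assms(1)]
    by (auto simp: auto_def iso_def Bij_def hom_def bij_betw_restrict_eq monoid.m_closed)
  with \<phi>(2) assms(2) show "\<exists>\<phi>\<in>auto G. \<phi> x = y"
    by (intro bexI[of _ "restrict \<phi> (carrier G)"]) auto
qed (auto simp: auto_def Bij_def iso_def)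

text \<open>Conjugation by \<open>\<theta>\<close> carries automorphisms of one group to
  automorphisms of the other.\<close>

lemma iso_orbit_transfer:
  assumes G: "group G" and \<theta>: "\<theta> \<in> iso G K" and x: "x \<in> carrier G" and y: "y \<in> carrier G"
  shows "(\<exists>\<phi>\<in>iso G G. \<phi> x = y) \<longleftrightarrow> (\<exists>\<psi>\<in>iso K K. \<psi> (\<theta> x) = \<theta> y)"
proof -
  let ?\<eta> = "inv_into (carrier G) \<theta>"
  have \<eta>: "?\<eta> \<in> iso K G" using group.iso_set_sym[OF G \<theta>] .
  have inj: "inj_on \<theta> (carrier G)" using \<theta> by (auto simp: iso_def bij_betw_def)
  show ?thesis
  proof
    assume "\<exists>\<phi>\<in>iso G G. \<phi> x = y"
    then obtain \<phi> where \<phi>: "\<phi> \<in> iso G G" "\<phi> x = y" by blast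
    have "\<theta> \<circ> (\<phi> \<circ> ?\<eta>) \<in> iso K K"
      by (intro iso_set_trans[OF iso_set_trans[OF \<eta> \<phi>(1)] \<theta>])
    then show "\<exists>\<psi>\<in>iso K K. \<psi> (\<theta> x) = \<theta> y"
      by (rule bexI[rotated]) (simp add: inj x \<phi>(2))
  next
    assume "\<exists>\<psi>\<in>iso K K. \<psi> (\<theta> x) = \<theta> y"
    then obtain \<psi> where \<psi>: "\<psi> \<in> iso K K" "\<psi> (\<theta> x) = \<theta> y" by blast
    have "?\<eta> \<circ> (\<psi> \<circ> \<theta>) \<in> iso G G"
      by (intro iso_set_trans[OF iso_set_trans[OF \<theta> \<psi>(1)] \<eta>])
    then show "\<exists>\<phi>\<in>iso G G. \<phi> x = y"
      by (rule bexI[rotated]) (simp add: inj y \<psi>(2))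
  qed
qed

text \<open>
  The letter codes are \<open>0, 1, 2, 3\<close> for \<open>a\<close>, \<open>a\<^sup>-\<^sup>1\<close>, \<open>t\<close>, \<open>t\<^sup>-\<^sup>1\<close>, and \<open>(r, i, j)\<close> stands for \<open>t\<^sup>-\<^sup>i a\<^sup>r t\<^sup>j\<close>,
  which is multiplied by the letter from the right.
\<close>

fun nf_step :: "int \<Rightarrow> nat \<Rightarrow> int \<times> nat \<times> nat \<Rightarrow> int \<times> nat \<times> nat" where
  "nf_step n c (r, i, j) =
     (if c = 0 then (r + n ^ j, i, j)
      else if c = 1 then (r - n ^ j, i, j)
      else if c = 2 then (r, i, Suc j)
      else if j = 0 then (n * r, Suc i, 0) else (r, i, j - 1))"

definition nf :: "int \<Rightarrow> nat word \<Rightarrow> int \<times> nat \<times> nat" where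
  "nf n w = fold (nf_step n) (map letter_code w) (0, 0, 0)"

text \<open>The rewriting into normal form depends only on the relation. The locale is instantiated
  with the presented group \<open>BS n\<close> and with the concrete groups
  \<open>bs_model n\<close> and \<open>integer_group\<close>, so that normal forms can be compared
  between them.\<close>

locale bs_rep = group +
  fixes \<alpha> \<tau> and n :: int
  assumes closed [simp, intro]: "\<alpha> \<in> carrier G" "\<tau> \<in> carrier G"
    and rel: "\<tau> \<otimes> \<alpha> = \<alpha> [^] n \<otimes> \<tau>"
begin

definition gen_val :: "nat \<Rightarrow> 'a" where
  "gen_val x = (if x = 0 then \<alpha> else \<tau>)"

fun nf_val :: "int \<times> nat \<times> nat \<Rightarrow> 'a" where
  "nf_val (r, i, j) = \<tau> [^] (- int i) \<otimes> (\<alpha> [^] r \<otimes> \<tau> [^] int j)"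

lemma gen_val_closed [simp]: "gen_val \<in> X \<rightarrow> carrier G"
  by (simp add: gen_val_def)

lemma alpha_eq_one: "n = 0 \<Longrightarrow> \<alpha> = \<one>"
  using rel by simp

text \<open>Conjugation by \<open>\<tau>\<close> is an endomorphism sending \<open>\<alpha>\<close>
  to its \<open>n\<close>-th power, hence it multiplies every exponent of \<open>\<alpha>\<close> by
  \<open>n\<close>, negative ones included.\<close>

lemma tau_alpha: "\<tau> \<otimes> \<alpha> [^] r = \<alpha> [^] (n * r) \<otimes> \<tau>" for r :: int
proof -
  have "(\<lambda>x. \<tau> \<otimes> x \<otimes> inv \<tau>) \<in> hom G G"
    by (auto simp: hom_def m_assoc) (simp flip: m_assoc)
  then interpret c: group_hom G G "\<lambda>x. \<tau> \<otimes> x \<otimes> inv \<tau>"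
    by unfold_locales
  have "\<tau> \<otimes> \<alpha> \<otimes> inv \<tau> = \<alpha> [^] n"
    by (simp add: rel m_assoc)
  then have "\<tau> \<otimes> \<alpha> [^] r \<otimes> inv \<tau> = \<alpha> [^] (n * r)"
    using c.hom_int_pow[of \<alpha> r] by (simp add: int_pow_pow)
  then show ?thesis
    by (metis closed int_pow_closed inv_closed inv_solve_right m_closed)
qed

lemma tau_pow_alpha: "\<tau> [^] int j \<otimes> \<alpha> [^] r = \<alpha> [^] (n ^ j * r) \<otimes> \<tau> [^] int j" for r :: int
proof (induction j arbitrary: r)
  case (Suc j)
  have "\<tau> [^] int (Suc j) = \<tau> [^] int j \<otimes> \<tau>"
    by (metis closed(2) int_pow_1 int_pow_mult of_nat_Suc add.commute)
  then have "\<tau> [^] int (Suc j) \<otimes> \<alpha> [^] r = \<tau> [^] int j \<otimes> (\<tau> \<otimes> \<alpha> [^] r)"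
    by (simp add: m_assoc del: of_nat_Suc)
  also have "\<dots> = (\<tau> [^] int j \<otimes> \<alpha> [^] (n * r)) \<otimes> \<tau>"
    by (simp add: tau_alpha m_assoc)
  also have "\<dots> = \<alpha> [^] (n ^ j * (n * r)) \<otimes> (\<tau> [^] int j \<otimes> \<tau>)"
    by (simp add: Suc.IH m_assoc)
  finally show ?case
    using \<open>\<tau> [^] int (Suc j) = \<tau> [^] int j \<otimes> \<tau>\<close> by (simp add: mult_ac)
qed simp

text \<open>An \<open>\<alpha>\<close> moved left past \<open>j\<close> factors
  \<open>\<tau>\<close> changes the exponent \<open>r\<close> by \<open>n ^ j\<close>. A
  \<open>\<tau>\<close> inverse cancels if \<open>j > 0\<close>; otherwise it moves left past the
  power of \<open>\<alpha>\<close>, multiplies \<open>r\<close> by \<open>n\<close> and joins the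
  left block.\<close>

lemma nf_val_step:
  assumes l: "l \<in> BS_gens \<times> UNIV"
  shows "nf_val p \<otimes> letter_val G gen_val l = nf_val (nf_step n (letter_code l) p)"
proof -
  obtain r i j where p: "p = (r, i, j)" by (cases p)
  have alpha: "nf_val p \<otimes> \<alpha> [^] s = nf_val (r + n ^ j * s, i, j)" for s :: int
  proof -
    have "nf_val p \<otimes> \<alpha> [^] s = \<tau> [^] (- int i) \<otimes> (\<alpha> [^] r \<otimes> (\<tau> [^] int j \<otimes> \<alpha> [^] s))"
      by (simp add: p m_assoc)
    also have "\<dots> = \<tau> [^] (- int i) \<otimes> ((\<alpha> [^] r \<otimes> \<alpha> [^] (n ^ j * s)) \<otimes> \<tau> [^] int j)"
      by (simp add: tau_pow_alpha m_assoc)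
    finally show ?thesis by (simp add: int_pow_mult)
  qed
  have tau: "nf_val p \<otimes> \<tau> [^] s = \<tau> [^] (- int i) \<otimes> (\<alpha> [^] r \<otimes> \<tau> [^] (int j + s))" for s :: int
    by (simp add: p m_assoc int_pow_mult)
  have neg: "\<alpha> [^] r \<otimes> \<tau> [^] (-1 :: int) = \<tau> [^] (-1 :: int) \<otimes> \<alpha> [^] (n * r)"
    using tau_alpha[of r]
    by (simp add: int_pow_neg int_pow_1) (metis closed(2) int_pow_closed closed(1) inv_closed inv_solve_left inv_solve_right m_assoc m_closed)
  have tau': "nf_val p \<otimes> \<tau> [^] (-1 :: int) = nf_val (nf_step n 3 p)"
  proof (cases j)
    case 0
    then have "nf_val p \<otimes> \<tau> [^] (-1 :: int) = \<tau> [^] (- int i) \<otimes> (\<tau> [^] (-1 :: int) \<otimes> \<alpha> [^] (n * r))"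
      unfolding tau using neg by simp
    also have "\<dots> = \<tau> [^] (- int i + -1) \<otimes> \<alpha> [^] (n * r)"
      unfolding int_pow_mult[OF closed(2)] by (simp add: m_assoc)
    also have "- int i + -1 = - int (Suc i)" by simp
    finally show ?thesis using 0 by (simp add: p del: of_nat_Suc)
  next
    case (Suc j')
    then show ?thesis unfolding tau by (simp add: p)
  qed
  have codes: "l = (0, False) \<or> l = (0, True) \<or> l = (1, False) \<or> l = (1, True)"
    using l by (cases l) (auto simp: BS_gens_def)
  then show ?thesis
    using alpha[of 1] alpha[of "-1"] tau[of 1] tau'
    by (auto simp: p letter_val_def letter_code_def gen_val_def int_pow_neg int_pow_1 add.commute
        numeral_3_eq_3)
qed

lemma word_val_nf:
  assumes "w \<in> words BS_gens"
  shows "word_val G gen_val w = nf_val (nf n w)"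
  using assms
proof (induction w rule: rev_induct)
  case Nil
  then show ?case by (simp add: word_val_def nf_def)
next
  case (snoc l w)
  then have l: "l \<in> BS_gens \<times> UNIV" and w: "w \<in> words BS_gens"
    by (auto simp: words_def)
  have "[l] \<in> words BS_gens" using l by (auto simp: words_def)
  then have "word_val G gen_val (w @ [l]) = word_val G gen_val w \<otimes> letter_val G gen_val l"
    using word_val_append[OF gen_val_closed w \<open>[l] \<in> words BS_gens\<close>]
      letter_val_closed[OF gen_val_closed l]
    by (simp add: word_val_def[of _ _ "[l]"])
  also have "\<dots> = nf_val (nf n (w @ [l]))"
    using snoc.IH[OF w] nf_val_step[OF l] by (simp add: nf_def)
  finally show ?case .
qed

text \<open>Surjectivity of the evaluation of words can therefore be checked on normal
  forms.\<close>

lemma nf_val_mem_image: "nf_val p \<in> word_val G gen_val ` words BS_gens"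
proof -
  obtain r i j where p: "p = (r, i, j)" by (cases p)
  define pw where "pw x (k :: int) = replicate (nat \<bar>k\<bar>) (x, k < 0)" for x :: nat and k
  have gens: "0 \<in> BS_gens" "1 \<in> BS_gens" by (auto simp: BS_gens_def)
  have words: "pw x k \<in> words BS_gens" if "x \<in> BS_gens" for x k
    using that by (auto simp: pw_def words_def)
  have rep: "word_val G gen_val (replicate k (x, b)) = letter_val G gen_val (x, b) [^] k" for k x b
  proof (induction k)
    case (Suc k)
    have "letter_val G gen_val (x, b) \<in> carrier G"
      by (rule letter_val_closed[of _ UNIV]) auto
    from nat_pow_Suc2[OF this] Suc show ?case by (simp add: word_val_def)
  qed (simp add: word_val_def)
  have gv: "gen_val x \<in> carrier G" for x by (simp add: gen_val_def)
  have pw: "word_val G gen_val (pw x k) = gen_val x [^] k" for x k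
  proof (cases "k < 0")
    case True
    then have "word_val G gen_val (pw x k) = (inv gen_val x) [^] nat (- k)"
      unfolding pw_def rep by (simp add: letter_val_def)
    with True show ?thesis by (simp only: nat_pow_inv[OF gv] int_pow_def2 if_True)
  next
    case False
    then show ?thesis
      unfolding pw_def rep by (simp add: letter_val_def)
  qed
  have "word_val G gen_val (pw 1 (- int i) @ pw 0 r @ pw 1 (int j)) = nf_val p"
    using word_val_append[OF gen_val_closed words[OF gens(2)], of "pw 0 r @ pw 1 (int j)"]
      word_val_append[OF gen_val_closed words[OF gens(1)] words[OF gens(2)], of r "int j"] words gens
    by (simp add: p pw gen_val_def words_def)
  moreover have "pw 1 (- int i) @ pw 0 r @ pw 1 (int j) \<in> words BS_gens"
    using words gens by (simp add: words_def)
  ultimately show ?thesis by (metis image_eqI)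
qed

end

section \<open>From the presented group to a concrete model\<close>

lemma bs_rep_BS: "bs_rep (BS n) (element_of BS_gens (BS_rels n) (gen 0)) (element_of BS_gens (BS_rels n) (gen 1)) n"
proof -
  let ?F = "free_group BS_gens" and ?e = "element_of BS_gens (BS_rels n)"
  interpret F: group ?F by (rule group_free_group)
  interpret group "BS n" by (rule group_BS)
  interpret group_hom ?F "BS n" ?e
    using element_of_hom[OF BS_rels_subset[of n]] by unfold_locales (simp add: BS_def)
  have g: "gen 0 \<in> carrier ?F" "gen 1 \<in> carrier ?F"
    by (auto intro: gen_carrier simp: BS_gens_def)
  define r where "r = inv\<^bsub>?F\<^esub> gen 1 \<otimes>\<^bsub>?F\<^esub> (gen 0 [^]\<^bsub>?F\<^esub> n) \<otimes>\<^bsub>?F\<^esub> gen 1 \<otimes>\<^bsub>?F\<^esub> inv\<^bsub>?F\<^esub> gen 0"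
  have r: "r \<in> BS_rels n" by (simp add: r_def BS_rels_def Let_def)
  then have "r \<in> carrier ?F" using BS_rels_subset by blast
  have "r = \<one>\<^bsub>?F\<^esub> \<otimes>\<^bsub>?F\<^esub> r \<otimes>\<^bsub>?F\<^esub> inv\<^bsub>?F\<^esub> \<one>\<^bsub>?F\<^esub>"
    using \<open>r \<in> carrier ?F\<close> by simp
  then have "r \<in> normal_closure ?F (BS_rels n)"
    unfolding normal_closure_def using r by (intro generate.incl) blast
  then have "?e r = \<one>\<^bsub>BS n\<^esub>"
    unfolding BS_def using element_of_eq_one[OF BS_rels_subset \<open>r \<in> carrier ?F\<close>] by blast
  moreover have "?e r = inv\<^bsub>BS n\<^esub> ?e (gen 1) \<otimes>\<^bsub>BS n\<^esub> (?e (gen 0) [^]\<^bsub>BS n\<^esub> n)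
      \<otimes>\<^bsub>BS n\<^esub> ?e (gen 1) \<otimes>\<^bsub>BS n\<^esub> inv\<^bsub>BS n\<^esub> ?e (gen 0)"
    using g by (simp add: r_def hom_int_pow)
  ultimately have "?e (gen 1) \<otimes>\<^bsub>BS n\<^esub> ?e (gen 0) = ?e (gen 0) [^]\<^bsub>BS n\<^esub> n \<otimes>\<^bsub>BS n\<^esub> ?e (gen 1)"
    using g by (intro conjugate_relation) auto
  then show ?thesis
    using g by unfold_locales auto
qed

text \<open>The hypotheses make the model isomorphic to \<open>BS n\<close>: a word trivial in the
  model has a trivial normal form by \<open>ker\<close>, and the same normal form is then trivial in
  \<open>BS n\<close>. For \<open>n = 0\<close> the exponent \<open>r\<close> may be arbitrary
  because there the relation makes the generator \<open>a\<close> trivial.\<close>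

lemma (in bs_rep) orbit_BS_iff:
  assumes surj: "carrier G \<subseteq> range nf_val"
    and ker: "\<And>r i j. nf_val (r, i, j) = \<one> \<Longrightarrow> i = j \<and> (n = 0 \<or> r = 0)"
    and u: "u \<in> words BS_gens" and v: "v \<in> words BS_gens"
  shows "(\<exists>\<phi>\<in>auto (BS n). \<phi> (element_of BS_gens (BS_rels n) u) = element_of BS_gens (BS_rels n) v)
    \<longleftrightarrow> (\<exists>\<psi>\<in>iso G G. \<psi> (nf_val (nf n u)) = nf_val (nf n v))"
proof -
  let ?F = "free_group BS_gens" and ?e = "element_of BS_gens (BS_rels n)"
  interpret F: group ?F by (rule group_free_group)
  interpret B: bs_rep "BS n" "?e (gen 0)" "?e (gen 1)" n by (rule bs_rep_BS)
  have e: "?e w = B.nf_val (nf n w)" if "w \<in> words BS_gens" for w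
  proof -
    have "?e w = word_val (BS n) (\<lambda>x. ?e (gen x)) w"
      unfolding BS_def by (rule element_of_eq_word_val[OF BS_rels_subset that])
    also have "\<dots> = word_val (BS n) B.gen_val w"
    proof -
      have "letter_val (BS n) (\<lambda>x. ?e (gen x)) l = letter_val (BS n) B.gen_val l" if "l \<in> set w" for l
      proof -
        have "fst l = 0 \<or> fst l = 1"
          using \<open>w \<in> words BS_gens\<close> that by (auto simp: words_def BS_gens_def)
        then have "?e (gen (fst l)) = B.gen_val (fst l)"
          by (metis B.gen_val_def zero_neq_one)
        then show ?thesis by (simp add: letter_val_def)
      qed
      then show ?thesis
        unfolding word_val_def by (intro foldr_cong) simp_all
    qed
    finally show ?thesis using B.word_val_nf[OF that] by simp
  qed
  have B_one: "B.nf_val (r, i, i) = \<one>\<^bsub>BS n\<^esub>" if "n = 0 \<or> r = 0" for r i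
  proof -
    have "?e (gen 0) [^]\<^bsub>BS n\<^esub> r = \<one>\<^bsub>BS n\<^esub>"
    proof (cases "r = 0")
      case False
      with that have "?e (gen 0) = \<one>\<^bsub>BS n\<^esub>" by (intro B.alpha_eq_one) simp
      then show ?thesis by simp
    qed simp
    then show ?thesis by (simp add: B.int_pow_neg del: One_nat_def)
  qed
  have rel: "word_val G gen_val r = \<one>" if "r \<in> BS_rels n" for r
  proof -
    interpret group_hom ?F G "word_val G gen_val"
      using word_val_hom[OF gen_val_closed] by unfold_locales
    have g: "gen 0 \<in> carrier ?F" "gen 1 \<in> carrier ?F"
      by (auto intro: gen_carrier simp: BS_gens_def)
    have gv: "word_val G gen_val (gen 0) = \<alpha>" "word_val G gen_val (gen 1) = \<tau>"
      by (simp_all add: word_val_def gen_def letter_val_def gen_val_def)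
    have "word_val G gen_val r = inv \<tau> \<otimes> \<alpha> [^] n \<otimes> \<tau> \<otimes> inv \<alpha>"
      using that g gv by (simp add: BS_rels_def hom_int_pow Let_def)
    also have "\<dots> = inv \<tau> \<otimes> (\<tau> \<otimes> \<alpha>) \<otimes> inv \<alpha>"
      by (simp add: rel m_assoc)
    also have "\<dots> = \<one>" by (simp flip: m_assoc)
    finally show ?thesis .
  qed
  have surj': "carrier G \<subseteq> word_val G gen_val ` words BS_gens"
    using surj nf_val_mem_image by blast
  have ker': "?e w = \<one>\<^bsub>BS n\<^esub>" if w: "w \<in> words BS_gens" "word_val G gen_val w = \<one>" for w
  proof -
    obtain r i j where nf: "nf n w = (r, i, j)" by (cases "nf n w")
    have "i = j \<and> (n = 0 \<or> r = 0)"
      by (rule ker) (use word_val_nf w nf in simp)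
    then show ?thesis using e[OF w(1)] B_one nf by simp
  qed
  obtain \<theta> where \<theta>: "\<theta> \<in> iso (BS n) G" "\<And>w. w \<in> words BS_gens \<Longrightarrow> \<theta> (?e w) = word_val G gen_val w"
    using presented_group_iso[OF is_group gen_val_closed BS_rels_subset rel surj', folded BS_def, OF _ ker']
    by blast
  have "?e u \<in> carrier (BS n)" "?e v \<in> carrier (BS n)"
    unfolding BS_def using u v by (auto intro: element_of_carrier)
  then show ?thesis
    using auto_conv_iso[OF group_BS] iso_orbit_transfer[OF group_BS \<theta>(1)] \<theta>(2) u v word_val_nf
    by simp
qed

section \<open>Congruences up to units of the localisation\<close>

text \<open>This replaces an unknown exponent by a bounded one. Multiplicities are compared prime by
  prime: a prime dividing \<open>n\<close> occurs at least \<open>e\<close> times in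
  \<open>n ^ e\<close>, and for any other prime the power of \<open>n\<close> contributes
  nothing.\<close>

lemma dvd_mult_power_bound:
  fixes a b n :: nat
  assumes dvd: "a dvd b * n ^ p" and n: "n \<noteq> 0"
    and bound: "\<And>q. prime q \<Longrightarrow> q dvd n \<Longrightarrow> multiplicity q a \<le> e"
  shows "a dvd b * n ^ e"
proof (cases "b = 0")
  case False
  have mult: "multiplicity q (b * n ^ k) = multiplicity q b + k * multiplicity q n" if "prime q" for q k
    using that False n
    by (simp add: prime_elem_multiplicity_mult_distrib prime_elem_multiplicity_power_distrib)
  have "a \<noteq> 0" using dvd False n by (intro notI) simp
  then show ?thesis
  proof (rule multiplicity_le_imp_dvd)
    fix q :: nat assume q: "prime q"
    show "multiplicity q a \<le> multiplicity q (b * n ^ e)"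
    proof (cases "q dvd n")
      case True
      then have "multiplicity q n \<ge> 1"
        using True prime_gt_1_nat[OF q] n multiplicity_eq_zero_iff[of n q] by auto
      then have "e \<le> multiplicity q (b * n ^ e)"
        unfolding mult[OF q] by (simp add: trans_le_add2)
      with bound[OF q True] show ?thesis by simp
    next
      case False
      then have "multiplicity q n = 0" by (simp add: not_dvd_imp_multiplicity_0)
      moreover have "multiplicity q a \<le> multiplicity q (b * n ^ p)"
        using dvd \<open>b \<noteq> 0\<close> n by (intro dvd_imp_multiplicity_le) auto
      ultimately show ?thesis by (simp add: mult[OF q])
    qed
  qed
qed simp

lemma multiplicity_le_nat:
  fixes a q :: nat
  assumes "prime q" "a \<noteq> 0"
  shows "multiplicity q a \<le> a"
proof -
  have "multiplicity q a < 2 ^ multiplicity q a" by (rule less_exp)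
  also have "\<dots> \<le> q ^ multiplicity q a"
    using prime_ge_2_nat[OF assms(1)] by (rule power_mono) simp
  also have "\<dots> \<le> a"
    using assms(2) by (intro dvd_imp_le multiplicity_dvd) simp
  finally show ?thesis by simp
qed

lemma nat_abs_dvd_mult_power:
  fixes x y n :: int
  shows "nat \<bar>x\<bar> dvd nat \<bar>y\<bar> * nat \<bar>n\<bar> ^ p \<longleftrightarrow> x dvd y * n ^ p"
proof -
  have "int (nat \<bar>y\<bar> * nat \<bar>n\<bar> ^ p) = \<bar>y * n ^ p\<bar>"
    by (simp add: abs_mult power_abs)
  then have "int (nat \<bar>x\<bar>) dvd int (nat \<bar>y\<bar> * nat \<bar>n\<bar> ^ p) \<longleftrightarrow> x dvd y * n ^ p"
    by (simp only: dvd_abs_iff abs_dvd_iff int_nat_eq abs_ge_zero if_True)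
  then show ?thesis by (simp only: of_nat_dvd_iff)
qed

text \<open>The exponent \<open>\<bar>x\<bar>\<close> is crude but computable from \<open>x\<close>:
  no prime has multiplicity above \<open>\<bar>x\<bar>\<close> in a non-zero
  \<open>x\<close>.\<close>

lemma dvd_mult_power_abs:
  fixes x y n :: int
  assumes "x dvd y * n ^ p" "n \<noteq> 0"
  shows "x dvd y * n ^ nat \<bar>x\<bar>"
proof (cases "x = 0")
  case False
  have "nat \<bar>x\<bar> dvd nat \<bar>y\<bar> * nat \<bar>n\<bar> ^ nat \<bar>x\<bar>"
  proof (rule dvd_mult_power_bound)
    show "nat \<bar>x\<bar> dvd nat \<bar>y\<bar> * nat \<bar>n\<bar> ^ p" by (simp only: nat_abs_dvd_mult_power assms)
    show "nat \<bar>n\<bar> \<noteq> 0" using assms by simp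
    show "multiplicity q (nat \<bar>x\<bar>) \<le> nat \<bar>x\<bar>" if "prime q" for q
      using that False by (intro multiplicity_le_nat) simp_all
  qed
  then show ?thesis by (simp only: nat_abs_dvd_mult_power)
qed (use assms in simp)

text \<open>
  The congruence \<open>\<alpha> x \<equiv> y\<close> modulo \<open>c\<close> in \<open>\<int>[1/n]\<close> for the unit \<open>\<alpha> = z / n\<^sup>j\<close>.
\<close>

definition unit_cong :: "int \<Rightarrow> int \<Rightarrow> int \<Rightarrow> int \<Rightarrow> bool" where
  "unit_cong n x y c \<longleftrightarrow> (\<exists>z p j. z dvd n ^ p \<and> c dvd z * x - y * n ^ j)"

text \<open>Modulo 0 the congruence is an equation saying that \<open>x\<close> and \<open>y\<close>
  are associated in \<int>[1/n]. This amounts to mutual divisibility up to powers of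
  \<open>n\<close>, and the exponents can be bounded.\<close>

lemma unit_cong_0_iff:
  assumes n: "n \<noteq> 0"
  shows "unit_cong n x y 0 \<longleftrightarrow> x dvd y * n ^ nat \<bar>x\<bar> \<and> y dvd x * n ^ nat \<bar>y\<bar>"
proof
  assume "unit_cong n x y 0"
  then obtain z p j where z: "z dvd n ^ p" "z * x = y * n ^ j"
    by (auto simp: unit_cong_def)
  then obtain w where w: "n ^ p = z * w" by (elim dvdE)
  have "x dvd y * n ^ j" by (simp flip: z(2))
  moreover have "x * n ^ p = (z * x) * w" by (simp add: w mult_ac)
  then have "y dvd x * n ^ p" by (simp add: z(2) mult.assoc)
  ultimately show "x dvd y * n ^ nat \<bar>x\<bar> \<and> y dvd x * n ^ nat \<bar>y\<bar>"
    using n by (blast intro: dvd_mult_power_abs)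
next
  assume "x dvd y * n ^ nat \<bar>x\<bar> \<and> y dvd x * n ^ nat \<bar>y\<bar>"
  then obtain z w where z: "y * n ^ nat \<bar>x\<bar> = x * z" and w: "x * n ^ nat \<bar>y\<bar> = y * w"
    by (elim conjE dvdE)
  show "unit_cong n x y 0"
  proof (cases "x = 0")
    case True
    then have "y = 0" using z n by simp
    then show ?thesis using True by (auto simp: unit_cong_def intro: exI[of _ 1])
  next
    case False
    then have y: "y \<noteq> 0" using w n by auto
    \<comment> \<open>Multiplying the two divisibilities shows that the quotients \<open>z\<close>
      and \<open>w\<close> have a power of \<open>n\<close> as product, so \<open>z\<close> is a
      unit of the localisation.\<close>
    have "(x * y) * (z * w) = (y * n ^ nat \<bar>x\<bar>) * (x * n ^ nat \<bar>y\<bar>)"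
      unfolding z w by (simp add: mult_ac)
    also have "\<dots> = (x * y) * n ^ (nat \<bar>x\<bar> + nat \<bar>y\<bar>)"
      by (simp add: power_add mult_ac)
    finally have "z * w = n ^ (nat \<bar>x\<bar> + nat \<bar>y\<bar>)"
      using False y by simp
    then have "z dvd n ^ (nat \<bar>x\<bar> + nat \<bar>y\<bar>)" by (metis dvd_triv_left)
    moreover have "0 dvd z * x - y * n ^ nat \<bar>x\<bar>" by (simp add: z mult.commute)
    ultimately show ?thesis unfolding unit_cong_def by blast
  qed
qed

text \<open>As \<open>c\<close> divides \<open>n ^ k - 1\<close>, the number \<open>n\<close> is
  invertible modulo \<open>c\<close> and the factor \<open>n ^ j\<close> can be absorbed into
  \<open>z\<close>. A least candidate for the absolute value of \<open>z\<close> contains each prime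
  at most \<open>\<bar>c\<bar>\<close> times, by Euler's theorem, so it divides
  \<open>n ^ \<bar>c\<bar>\<close> and the search is finite.\<close>

lemma unit_cong_geometric_iff:
  fixes n x y :: int and k :: nat
  defines "c \<equiv> (\<Sum>i<k. n ^ i)"
  assumes n: "n \<noteq> 0" and c: "c \<noteq> 0"
  shows "unit_cong n x y c \<longleftrightarrow>
    (\<exists>w<Suc (nat (\<bar>n\<bar> ^ nat \<bar>c\<bar>)). int w dvd n ^ nat \<bar>c\<bar> \<and> (c dvd int w * x - y \<or> c dvd int w * x + y))"
    (is "_ \<longleftrightarrow> ?R")
proof
  assume ?R
  then obtain w where w: "int w dvd n ^ nat \<bar>c\<bar>" "c dvd int w * x - y \<or> c dvd int w * x + y"
    by blast
  from w(2) show "unit_cong n x y c"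
  proof
    assume "c dvd int w * x - y"
    with w(1) show ?thesis
      unfolding unit_cong_def by (intro exI[of _ "int w"] exI[of _ "nat \<bar>c\<bar>"] exI[of _ 0]) simp
  next
    assume "c dvd int w * x + y"
    then have "c dvd - (int w * x + y)" by (simp only: dvd_minus_iff)
    also have "- (int w * x + y) = - int w * x - y" by simp
    finally show ?thesis
      using w(1) unfolding unit_cong_def
      by (intro exI[of _ "- int w"] exI[of _ "nat \<bar>c\<bar>"] exI[of _ 0]) simp
  qed
next
  assume "unit_cong n x y c"
  then obtain z p j where z: "z dvd n ^ p" "c dvd z * x - y * n ^ j"
    by (auto simp: unit_cong_def)
  define m where "m = nat \<bar>c\<bar>"
  have m: "m > 0" using c by (simp add: m_def)
  have k: "k > 0" using c by (cases k) (simp_all add: c_def)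
  have geo: "(n - 1) * c = n ^ k - 1"
    unfolding c_def by (simp add: power_diff_1_eq)
  have coprime: "coprime n c"
  proof (rule coprimeI)
    fix d assume "d dvd n" "d dvd c"
    then have "d dvd n ^ k - (n - 1) * c"
      using k by (intro dvd_diff dvd_mult) (auto intro: dvd_power dvd_trans)
    then show "is_unit d" by (simp add: geo)
  qed
  \<comment> \<open>The candidates are absolute values of units; the two alternatives account for
    the sign of the unit.\<close>
  define good where "good a \<longleftrightarrow> (\<exists>p. int a dvd n ^ p) \<and> (c dvd int a * x - y \<or> c dvd int a * x + y)" for a
  have "\<exists>a. good a"
  proof -
    \<comment> \<open>The extra factor turns \<open>n ^ j\<close> into \<open>n ^ (k * j)\<close>,
      which is 1 modulo \<open>c\<close>.\<close>
    define z' where "z' = z * n ^ (j * (k - 1))"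
    have "c dvd n ^ k - 1" using geo by (metis dvd_triv_right)
    also have "n ^ k - 1 dvd (n ^ k) ^ j - 1" by (simp add: power_diff_1_eq)
    finally have "c dvd y * ((n ^ k) ^ j - 1)" by (rule dvd_mult)
    moreover have "c dvd (z * x - y * n ^ j) * n ^ (j * (k - 1))" using z(2) by (rule dvd_mult2)
    moreover have "(z * x - y * n ^ j) * n ^ (j * (k - 1)) + y * ((n ^ k) ^ j - 1) = z' * x - y"
    proof -
      have "j + j * (k - 1) = k * j" using k by (cases k) auto
      then have "n ^ j * n ^ (j * (k - 1)) = (n ^ k) ^ j"
        by (simp add: power_mult[symmetric] flip: power_add)
      then show ?thesis by (simp add: z'_def algebra_simps)
    qed
    ultimately have z'x: "c dvd z' * x - y" by (metis dvd_add)
    have "z' dvd n ^ (p + j * (k - 1))"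
      unfolding z'_def power_add using z(1) by (intro mult_dvd_mono) auto
    moreover have "c dvd \<bar>z'\<bar> * x - y \<or> c dvd \<bar>z'\<bar> * x + y"
    proof (cases "z' \<ge> 0")
      case False
      have "c dvd - (z' * x - y)" using z'x by (simp only: dvd_minus_iff)
      then show ?thesis using False by simp
    qed (use z'x in simp)
    ultimately have "good (nat \<bar>z'\<bar>)"
      unfolding good_def by auto
    then show ?thesis by blast
  qed
  define a where "a = (LEAST a. good a)"
  have a: "good a" unfolding a_def using \<open>\<exists>a. good a\<close> by (rule LeastI_ex)
  then obtain p' where p': "int a dvd n ^ p'" by (auto simp: good_def)
  have a0: "a \<noteq> 0" using p' n by (intro notI) simp
  \<comment> \<open>Otherwise \<open>a\<close> could be divided by a power of \<open>q\<close> that is \<open>1\<close> modulo \<open>c\<close>.\<close>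
  have "multiplicity q a \<le> m" if q: "prime q" "q dvd nat \<bar>n\<bar>" for q
  proof (rule ccontr)
    assume "\<not> multiplicity q a \<le> m"
    then have "q ^ m dvd a" by (intro multiplicity_dvd') simp
    define E where "E = totient m"
    have E: "0 < E" "E \<le> m" using m by (simp_all add: E_def totient_le)
    have "q ^ E dvd a" using \<open>q ^ m dvd a\<close> E(2) by (meson dvd_trans le_imp_power_dvd)
    then obtain b where b: "a = q ^ E * b" by (elim dvdE)
    have "int q dvd n" using q(2) nat_abs_dvd_mult_power[of "int q" 1 n 1] by simp
    then have "coprime (int q) c" using coprime by (meson coprime_divisors dvd_refl)
    then have "coprime q m" using coprime_int_iff[of q m] by (simp add: m_def)
    then have "[q ^ E = 1] (mod m)" unfolding E_def by (rule euler_theorem)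
    then have "[int (q ^ E) = int 1] (mod int m)" by (simp only: cong_int_iff)
    then have "int m dvd int (q ^ E) - 1" by (simp add: cong_iff_dvd_diff)
    then have "c dvd int (q ^ E) - 1" by (simp add: m_def)
    then have qE: "c dvd (int (q ^ E) - 1) * (int b * x)" by (rule dvd_mult2)
    have eq: "int b * x + s = (int a * x + s) - (int (q ^ E) - 1) * (int b * x)" for s
      by (simp add: b algebra_simps)
    have "c dvd int b * x + s" if "c dvd int a * x + s" for s
      unfolding eq[of s] using that qE by (rule dvd_diff)
    from this[of "- y"] this[of y] a have "c dvd int b * x - y \<or> c dvd int b * x + y"
      by (auto simp: good_def)
    moreover have "int b dvd int a" by (simp add: b)
    then have "int b dvd n ^ p'" using p' by (rule dvd_trans)
    ultimately have "good b" by (auto simp: good_def)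
    then have "a \<le> b" unfolding a_def by (rule Least_le)
    moreover have "1 < q ^ E" using E(1) prime_gt_1_nat[OF q(1)] by (intro one_less_power)
    ultimately show False using a0 b by simp
  qed
  moreover have "a dvd 1 * nat \<bar>n\<bar> ^ p'"
    using p' nat_abs_dvd_mult_power[of "int a" 1 n p'] by simp
  moreover have "nat \<bar>n\<bar> \<noteq> 0" using n by simp
  ultimately have a_dvd: "a dvd 1 * nat \<bar>n\<bar> ^ m" by (metis dvd_mult_power_bound)
  then have "a \<le> nat (\<bar>n\<bar> ^ m)" using n by (intro dvd_imp_le) (auto simp: nat_power_eq)
  moreover have "int a dvd n ^ m"
    using a_dvd nat_abs_dvd_mult_power[of "int a" 1 n m] by simp
  ultimately show ?R
    using a unfolding good_def m_def by (intro exI[of _ a]) auto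
qed

section \<open>The semidirect product and its automorphisms\<close>

text \<open>The ring \<open>\<int>[1/n]\<close>.\<close>

definition loc :: "int \<Rightarrow> rat set" where
  "loc n = {r. \<exists>i. r * of_int n ^ i \<in> \<int>}"

lemma of_int_loc [simp]: "of_int x \<in> loc n"
  unfolding loc_def by (auto intro: exI[of _ 0])

lemma loc_0_1 [simp]: "0 \<in> loc n" "1 \<in> loc n"
  using of_int_loc[of 0] of_int_loc[of 1] by simp_all

lemma loc_uminus [simp]: "r \<in> loc n \<Longrightarrow> - r \<in> loc n"
  unfolding loc_def by auto

lemma loc_add [simp]:
  assumes "r \<in> loc n" "s \<in> loc n"
  shows "r + s \<in> loc n"
proof -
  obtain i j where "r * of_int n ^ i \<in> \<int>" "s * of_int n ^ j \<in> \<int>"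
    using assms by (auto simp: loc_def)
  then have "(r * of_int n ^ i) * of_int n ^ j + (s * of_int n ^ j) * of_int n ^ i \<in> \<int>" by simp
  then have "(r + s) * of_int n ^ (i + j) \<in> \<int>" by (simp add: algebra_simps power_add)
  then show ?thesis by (auto simp: loc_def)
qed

lemma loc_diff [simp]: "r \<in> loc n \<Longrightarrow> s \<in> loc n \<Longrightarrow> r - s \<in> loc n"
  using loc_add[of r n "- s"] by simp

lemma loc_mult [simp]:
  assumes "r \<in> loc n" "s \<in> loc n"
  shows "r * s \<in> loc n"
proof -
  obtain i j where "r * of_int n ^ i \<in> \<int>" "s * of_int n ^ j \<in> \<int>"
    using assms by (auto simp: loc_def)
  then have "(r * of_int n ^ i) * (s * of_int n ^ j) \<in> \<int>" by simp
  then have "(r * s) * of_int n ^ (i + j) \<in> \<int>" by (simp add: algebra_simps power_add)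
  then show ?thesis by (auto simp: loc_def)
qed

lemma loc_power_int [simp]:
  assumes "n \<noteq> 0"
  shows "of_int n powi k \<in> loc n"
proof (cases "k \<ge> 0")
  case True
  then have "of_int n powi k = (of_int (n ^ nat k) :: rat)" by (simp add: power_int_def)
  then show ?thesis by (simp only: of_int_loc)
next
  case False
  then have "of_int n powi k * of_int n ^ nat (- k) = (1 :: rat)"
    using assms by (simp add: power_int_def power_inverse)
  then show ?thesis unfolding loc_def by (auto intro: exI[of _ "nat (- k)"])
qed

lemma locE:
  assumes "r \<in> loc n" "n \<noteq> 0"
  obtains x i where "r = of_int x / of_int n ^ i" "r * of_int n ^ i = of_int x"
proof -
  obtain i where "r * of_int n ^ i \<in> \<int>" using assms by (auto simp: loc_def)
  then obtain x where "r * of_int n ^ i = of_int x" by (elim Ints_cases)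
  then show thesis using that[of x i] assms(2) by (simp add: eq_divide_eq)
qed

text \<open>Additivity gives compatibility with integer multiples. Applied to \<open>n ^ i\<close>
  times \<open>r\<close> it determines \<open>f r\<close>, since \<open>n ^ i\<close> can be
  cancelled among the rational values.\<close>

lemma additive_loc:
  fixes f :: "rat \<Rightarrow> rat"
  assumes n: "n \<noteq> 0" and add: "\<And>r s. r \<in> loc n \<Longrightarrow> s \<in> loc n \<Longrightarrow> f (r + s) = f r + f s"
    and r: "r \<in> loc n"
  shows "f r = r * f 1"
proof -
  have f0: "f 0 = 0" using add[of 0 0] by simp
  have nat: "f (of_nat k * r) = of_nat k * f r" if "r \<in> loc n" for k r
  proof (induction k)
    case (Suc k)
    have "of_nat k * r \<in> loc n" using that of_int_loc[of "int k" n] by (intro loc_mult) simp_all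
    with Suc show ?case using add[of r "of_nat k * r"] that by (simp add: algebra_simps)
  qed (simp add: f0)
  have minus: "f (- r) = - f r" if "r \<in> loc n" for r
    using add[of r "- r"] that f0 by (simp add: eq_neg_iff_add_eq_0 add.commute)
  have int: "f (of_int k * r) = of_int k * f r" if "r \<in> loc n" for k r
  proof (cases "k \<ge> 0")
    case True
    then show ?thesis using nat[OF that, of "nat k"] by simp
  next
    case False
    then show ?thesis
      using nat[of "- r" "nat (- k)"] minus[OF that] that by simp
  qed
  obtain x i where x: "r = of_int x / of_int n ^ i" "r * of_int n ^ i = of_int x"
    using locE[OF r n] .
  have "of_int (n ^ i) * f r = f (of_int x * 1)"
    using int[OF r, of "n ^ i"] x(2) by (simp add: mult.commute)
  also have "\<dots> = of_int x * f 1" by (rule int) simp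
  finally show ?thesis using n by (simp add: x(1) field_simps)
qed

definition bs_model :: "int \<Rightarrow> (rat \<times> int) monoid" where
  "bs_model n = \<lparr>carrier = loc n \<times> UNIV,
     monoid.mult = (\<lambda>(r, k) (s, l). (r + of_int n powi k * s, k + l)), one = (0, 0)\<rparr>"

lemma bs_model_simps [simp]:
  "carrier (bs_model n) = loc n \<times> UNIV"
  "(r, k) \<otimes>\<^bsub>bs_model n\<^esub> (s, l) = (r + of_int n powi k * s, k + l)"
  "\<one>\<^bsub>bs_model n\<^esub> = (0, 0)"
  by (simp_all add: bs_model_def)

lemma group_bs_model:
  assumes n: "n \<noteq> 0"
  shows "group (bs_model n)"
proof (rule groupI)
  fix x y z
  assume "x \<in> carrier (bs_model n)" "y \<in> carrier (bs_model n)" "z \<in> carrier (bs_model n)"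
  then obtain r s t k l m where xyz: "x = (r, k)" "y = (s, l)" "z = (t, m)"
    and loc: "r \<in> loc n" "s \<in> loc n" "t \<in> loc n"
    by auto
  show "x \<otimes>\<^bsub>bs_model n\<^esub> y \<in> carrier (bs_model n)"
    using loc n by (simp add: xyz)
  show "x \<otimes>\<^bsub>bs_model n\<^esub> y \<otimes>\<^bsub>bs_model n\<^esub> z = x \<otimes>\<^bsub>bs_model n\<^esub> (y \<otimes>\<^bsub>bs_model n\<^esub> z)"
    using n by (simp add: xyz algebra_simps power_int_add)
next
  fix x assume "x \<in> carrier (bs_model n)"
  then obtain r k where x: "x = (r, k)" "r \<in> loc n" by auto
  then show "\<one>\<^bsub>bs_model n\<^esub> \<otimes>\<^bsub>bs_model n\<^esub> x = x" by simp
  show "\<exists>y\<in>carrier (bs_model n). y \<otimes>\<^bsub>bs_model n\<^esub> x = \<one>\<^bsub>bs_model n\<^esub>"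
    using x n by (intro bexI[of _ "(- (of_int n powi (- k) * r), - k)"]) auto
qed auto

lemma bs_model_inv:
  assumes "n \<noteq> 0" "r \<in> loc n"
  shows "inv\<^bsub>bs_model n\<^esub> (r, k) = (- (of_int n powi (- k) * r), - k)"
  by (rule group.inv_equality[OF group_bs_model]) (use assms in auto)

lemma bs_model_pow_a:
  fixes x :: int
  assumes "n \<noteq> 0"
  shows "(1, 0) [^]\<^bsub>bs_model n\<^esub> x = (of_int x, 0)"
proof -
  interpret group "bs_model n" by (rule group_bs_model[OF assms])
  have c: "(1, 0) \<in> carrier (bs_model n)" by simp
  show ?thesis
  proof (induction x rule: int_induct[of _ 0])
    case (step1 i)
    then show ?case unfolding int_pow_mult[OF c] by (simp add: int_pow_1[OF c])
  next
    case (step2 i)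
    have "(1, 0) [^]\<^bsub>bs_model n\<^esub> (i - 1) = (1, 0) [^]\<^bsub>bs_model n\<^esub> i \<otimes>\<^bsub>bs_model n\<^esub> inv\<^bsub>bs_model n\<^esub> (1, 0)"
      using int_pow_diff[OF c, of i 1] by (simp add: int_pow_1[OF c])
    then show ?case by (simp add: step2 bs_model_inv assms)
  qed simp
qed

lemma bs_model_pow_t:
  fixes x :: int
  assumes "n \<noteq> 0"
  shows "(0, 1) [^]\<^bsub>bs_model n\<^esub> x = (0, x)"
proof -
  interpret group "bs_model n" by (rule group_bs_model[OF assms])
  have c: "(0, 1) \<in> carrier (bs_model n)" by simp
  show ?thesis
  proof (induction x rule: int_induct[of _ 0])
    case (step1 i)
    then show ?case unfolding int_pow_mult[OF c] by (simp add: int_pow_1[OF c])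
  next
    case (step2 i)
    have "(0, 1) [^]\<^bsub>bs_model n\<^esub> (i - 1) = (0, 1) [^]\<^bsub>bs_model n\<^esub> i \<otimes>\<^bsub>bs_model n\<^esub> inv\<^bsub>bs_model n\<^esub> (0, 1)"
      using int_pow_diff[OF c, of i 1] by (simp add: int_pow_1[OF c])
    then show ?case by (simp add: step2 bs_model_inv assms)
  qed simp
qed

lemma bs_rep_bs_model:
  assumes "n \<noteq> 0"
  shows "bs_rep (bs_model n) (1, 0) (0, 1) n"
proof -
  interpret group "bs_model n" by (rule group_bs_model[OF assms])
  show ?thesis
    by unfold_locales (simp_all add: bs_model_pow_a assms)
qed

lemma nf_val_bs_model:
  assumes "n \<noteq> 0"
  shows "bs_rep.nf_val (bs_model n) (1, 0) (0, 1) (x, i, j) = (of_int x / of_int n ^ i, int j - int i)"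
proof -
  interpret bs_rep "bs_model n" "(1, 0)" "(0, 1)" n by (rule bs_rep_bs_model[OF assms])
  show ?thesis
    by (simp add: bs_model_pow_a bs_model_pow_t assms power_int_minus field_simps)
qed

lemma orbit_BS_iff_bs_model:
  assumes n: "n \<noteq> 0" and u: "u \<in> words BS_gens" and v: "v \<in> words BS_gens"
    and nf: "nf n u = (x, i, j)" "nf n v = (x', i', j')"
  shows "(\<exists>\<phi>\<in>auto (BS n). \<phi> (element_of BS_gens (BS_rels n) u) = element_of BS_gens (BS_rels n) v)
    \<longleftrightarrow> (\<exists>\<psi>\<in>iso (bs_model n) (bs_model n). \<psi> (of_int x / of_int n ^ i, int j - int i)
          = (of_int x' / of_int n ^ i', int j' - int i'))"
proof -
  interpret bs_rep "bs_model n" "(1, 0)" "(0, 1)" n by (rule bs_rep_bs_model[OF n])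
  note val = nf_val_bs_model[OF n]
  have "carrier (bs_model n) \<subseteq> range nf_val"
  proof
    fix p assume "p \<in> carrier (bs_model n)"
    then obtain r k where p: "p = (r, k)" "r \<in> loc n" by auto
    obtain x i where x: "r = of_int x / of_int n ^ i" using locE[OF p(2) n] .
    \<comment> \<open>Expanding the fraction by \<open>n ^ e\<close> makes the left exponent so
      large that the right exponent \<open>k + i + e\<close> is not negative.\<close>
    define e where "e = nat (- k)"
    have "r = of_int (x * n ^ e) / of_int n ^ (i + e)"
      using n by (simp add: x power_add)
    then have "p = nf_val (x * n ^ e, i + e, nat (k + int (i + e)))"
      by (simp only: val p(1)) (simp add: e_def)
    then show "p \<in> range nf_val" by blast
  qed
  moreover have "i = j \<and> (n = 0 \<or> r = 0)" if "nf_val (r, i, j) = \<one>\<^bsub>bs_model n\<^esub>" for r i j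
    using that n by (simp add: val del: nf_val.simps)
  ultimately show ?thesis
    using orbit_BS_iff[OF _ _ u v] by (simp only: nf val)
qed

section \<open>Automorphisms of the semidirect product\<close>

definition geo :: "int \<Rightarrow> int \<Rightarrow> rat" where
  "geo n k = (of_int n powi k - 1) / (of_int n - 1)"

text \<open>For \<open>n\<close> different from 0 and 1, \<open>geo n k\<close> is the first
  coordinate of the \<open>k\<close>-th power of \<open>(1, 1)\<close> in \<open>bs_model n\<close>.
  This cocycle identity makes the affine maps homomorphisms.\<close>

lemma geo_add:
  assumes "n \<noteq> 0" "n \<noteq> 1"
  shows "geo n (k + l) = geo n k + of_int n powi k * geo n l"
  unfolding geo_def times_divide_eq_right add_divide_distrib[symmetric]
  using assms by (simp add: power_int_add algebra_simps)

lemma geo_nonneg: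
  assumes "n \<noteq> 1" "k \<ge> 0"
  shows "geo n k = of_int (\<Sum>i<nat k. n ^ i)"
proof -
  have "(of_int n - 1) * of_int (\<Sum>i<nat k. n ^ i) = (of_int n ^ nat k - 1 :: rat)"
    by (simp add: power_diff_1_eq)
  moreover have "(of_int n - 1 :: rat) \<noteq> 0" using assms(1) by simp
  ultimately show ?thesis using assms(2)
    by (simp add: geo_def power_int_def field_simps)
qed

lemma geo_minus:
  assumes "n \<noteq> 0" "n \<noteq> 1"
  shows "geo n (- k) = - (of_int n powi (- k) * geo n k)"
  using geo_add[OF assms, of "- k" k] by (simp add: geo_def)

lemma geo_loc [simp]:
  assumes "n \<noteq> 0" "n \<noteq> 1"
  shows "geo n k \<in> loc n"
proof (cases "k \<ge> 0")
  case False
  then have "geo n (- k) = of_int (\<Sum>i<nat (- k). n ^ i)"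
    using assms by (intro geo_nonneg) auto
  then have "geo n (- k) \<in> loc n" by (simp only: of_int_loc)
  then show ?thesis using geo_minus[OF assms, of "- k"] assms(1) by simp
qed (use assms geo_nonneg[of n k] of_int_loc in \<open>simp del: of_int_sum\<close>)

text \<open>Here \<open>\<alpha>\<close> is a unit with inverse \<open>\<alpha>'\<close>. With
  \<open>c = geo n k\<close> the condition describes which first coordinates can be reached from
  \<open>(r, k)\<close>; \<open>c\<close> is kept free so that it can be exchanged for an associated
  integer.\<close>

definition affine_orbit :: "int \<Rightarrow> rat \<Rightarrow> rat \<Rightarrow> rat \<Rightarrow> bool" where
  "affine_orbit n r s c \<longleftrightarrow>
     (\<exists>\<alpha>\<in>loc n. \<exists>\<alpha>'\<in>loc n. \<exists>\<beta>\<in>loc n. \<alpha> * \<alpha>' = 1 \<and> \<alpha> * r + \<beta> * c = s)"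

text \<open>The subgroup of pairs with second coordinate 0 is preserved, and there
  \<open>\<psi>\<close> is additive, hence multiplication by a constant. Surjectivity makes that
  constant a unit and \<open>\<epsilon>\<close> a sign. The image of \<open>t\<close> determines the
  rest.\<close>

lemma bs_model_iso_form:
  assumes n: "n \<noteq> 0" "n \<noteq> 1" and \<psi>: "\<psi> \<in> iso (bs_model n) (bs_model n)"
  obtains \<alpha> \<alpha>' \<beta> \<epsilon> where "\<alpha> \<in> loc n" "\<alpha>' \<in> loc n" "\<beta> \<in> loc n" "\<alpha> * \<alpha>' = 1" "\<epsilon> = 1 \<or> \<epsilon> = -1"
    "of_int n powi \<epsilon> = (of_int n :: rat)" "\<And>r k. r \<in> loc n \<Longrightarrow> \<psi> (r, k) = (\<alpha> * r + \<beta> * geo n k, \<epsilon> * k)"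
proof -
  let ?q = "of_int n :: rat"
  have q: "?q \<noteq> 0" "?q \<noteq> 1" using n by simp_all
  have mult: "\<psi> (r + ?q powi k * s, k + l) = \<psi> (r, k) \<otimes>\<^bsub>bs_model n\<^esub> \<psi> (s, l)"
    if "r \<in> loc n" "s \<in> loc n" for r s k l
  proof -
    have "\<psi> ((r, k) \<otimes>\<^bsub>bs_model n\<^esub> (s, l)) = \<psi> (r, k) \<otimes>\<^bsub>bs_model n\<^esub> \<psi> (s, l)"
      using \<psi> that unfolding iso_def by (intro hom_mult[of \<psi>]) auto
    then show ?thesis by simp
  qed
  have bij: "bij_betw \<psi> (loc n \<times> UNIV) (loc n \<times> UNIV)"
    using \<psi> by (simp add: iso_def)
  define \<delta> where "\<delta> r = snd (\<psi> (r, 0))" for r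
  define A where "A r = fst (\<psi> (r, 0))" for r
  define D where "D k = fst (\<psi> (0, k))" for k
  define \<epsilon> where "\<epsilon> = snd (\<psi> (0, 1))"
  have times: "x \<otimes>\<^bsub>bs_model n\<^esub> y = (fst x + ?q powi snd x * fst y, snd x + snd y)" for x y
    by (cases x; cases y) simp
  have in_loc: "fst (\<psi> (r, k)) \<in> loc n" if "r \<in> loc n" for r k
    using bij_betwE[OF bij] that by (metis SigmaI UNIV_I mem_Times_iff)
  have \<delta>_add: "\<delta> (r + s) = \<delta> r + \<delta> s" if "r \<in> loc n" "s \<in> loc n" for r s
    using mult[OF that, of 0 0] by (simp add: \<delta>_def times)
  have \<delta>_lin: "of_int (\<delta> r) = r * of_int (\<delta> 1)" if "r \<in> loc n" for r
    by (rule additive_loc[where f = "\<lambda>r. of_int (\<delta> r)", OF n(1) _ that]) (simp add: \<delta>_add)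
  \<comment> \<open>Both lines evaluate \<open>\<psi>\<close> on the same element, written as
    \<open>t\<close> times \<open>r\<close> and as \<open>n * r\<close> times
    \<open>t\<close>.\<close>
  have shift: "\<psi> (?q * r, 1) = \<psi> (0, 1) \<otimes>\<^bsub>bs_model n\<^esub> \<psi> (r, 0)"
    "\<psi> (?q * r, 1) = \<psi> (?q * r, 0) \<otimes>\<^bsub>bs_model n\<^esub> \<psi> (0, 1)" if "r \<in> loc n" for r
    using mult[of 0 r 1 0] mult[of "?q * r" 0 0 1] that by simp_all
  \<comment> \<open>The second coordinates of \<open>shift\<close> add up in a commutative group, so
    \<open>\<delta>\<close> agrees at \<open>n\<close> and at 1; by linearity and
    \<open>n \<noteq> 1\<close> it vanishes.\<close>
  have "\<delta> ?q = \<delta> 1"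
    using shift[of 1] by (simp add: \<delta>_def times)
  then have "?q * of_int (\<delta> 1) = of_int (\<delta> 1)"
    using \<delta>_lin[of ?q] by simp
  then have "\<delta> 1 = 0" using q by simp
  then have \<delta>0: "\<delta> r = 0" if "r \<in> loc n" for r using \<delta>_lin[OF that] by simp
  have \<psi>A: "\<psi> (r, 0) = (A r, 0)" if "r \<in> loc n" for r
    using \<delta>0[OF that] by (simp add: A_def \<delta>_def prod_eq_iff)
  have snd_t: "snd (\<psi> (0, k)) = \<epsilon> * k" for k
  proof -
    have add: "snd (\<psi> (0, k + l)) = snd (\<psi> (0, k)) + snd (\<psi> (0, l))" for k l
      using mult[of 0 0 k l] by (simp add: times)
    have "snd (\<psi> (0, 0)) = 0" using \<psi>A[of 0] by simp
    then show ?thesis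
    proof (induction k rule: int_induct[of _ 0])
      case (step1 i)
      then show ?case using add[of i 1] by (simp add: \<epsilon>_def algebra_simps)
    next
      case (step2 i)
      then show ?case using add[of "i - 1" 1] by (simp add: \<epsilon>_def algebra_simps)
    qed simp
  qed
  have \<psi>D: "\<psi> (0, k) = (D k, \<epsilon> * k)" for k
    using snd_t[of k] by (simp add: D_def prod_eq_iff)
  have A_add: "A (r + s) = A r + A s" if "r \<in> loc n" "s \<in> loc n" for r s
    using mult[OF that, of 0 0] that by (simp add: \<psi>A)
  have A_lin: "A r = A 1 * r" if "r \<in> loc n" for r
    using additive_loc[where f = A, OF n(1) A_add that] by (simp add: mult.commute)
  have form: "\<psi> (r, k) = (A 1 * r + D k, \<epsilon> * k)" if "r \<in> loc n" for r k
    using mult[of r 0 0 k] that by (simp add: \<psi>A \<psi>D A_lin[OF that])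
  have \<alpha>: "A 1 \<in> loc n" and \<beta>: "D 1 \<in> loc n"
    using in_loc by (simp_all add: A_def D_def)
  \<comment> \<open>A preimage of \<open>(0, 1)\<close> shows that \<open>\<epsilon>\<close> is
    invertible, and one of \<open>(1, 0)\<close> yields the inverse of \<open>A 1\<close>.\<close>
  have "(1, 0) \<in> \<psi> ` (loc n \<times> UNIV)" and "(0, 1) \<in> \<psi> ` (loc n \<times> UNIV)"
    using bij by (auto simp: bij_betw_def)
  then obtain r k r' k' where rk: "r \<in> loc n" "\<psi> (r, k) = (1, 0)" "r' \<in> loc n" "\<psi> (r', k') = (0, 1)"
    by (auto simp: image_iff)
  have "\<epsilon> * k' = 1" using form[OF rk(3), of k'] rk(4) by simp
  then have \<epsilon>: "\<epsilon> = 1 \<or> \<epsilon> = -1" by (rule pos_zmult_eq_1_iff_lemma)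
  then have "k = 0" using form[OF rk(1), of k] rk(2) by auto
  have "D 0 = 0" using \<psi>D[of 0] \<psi>A[of 0] A_lin[of 0] by simp
  then have unit: "A 1 * r = 1" using form[OF rk(1), of k] rk(2) \<open>k = 0\<close> by simp
  then have "A 1 \<noteq> 0" by auto
  \<comment> \<open>First coordinates of \<open>shift\<close> at \<open>r = 1\<close>: the image of
    \<open>t\<close> must still act as multiplication by \<open>n\<close>.\<close>
  have "D 1 + ?q powi \<epsilon> * A 1 = A ?q + D 1"
    using shift[of 1] \<psi>A[of 1] \<psi>A[of ?q] \<psi>D[of 1] by simp
  then have q\<epsilon>: "?q powi \<epsilon> = ?q"
    using A_lin[of ?q] \<open>A 1 \<noteq> 0\<close> by simp
  then have q\<epsilon>k: "?q powi (\<epsilon> * k) = ?q powi k" for k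
    by (simp add: power_int_mult)
  \<comment> \<open>Compare the images of \<open>t\<^sup>k t\<close> and \<open>t t\<^sup>k\<close>.\<close>
  have D_geo: "D k = D 1 * geo n k" for k
  proof -
    have "D k + ?q powi k * D 1 = D 1 + ?q * D k"
      using mult[of 0 0 k 1] mult[of 0 0 1 k] \<psi>D q\<epsilon>k[of k] q\<epsilon>k[of 1] by (simp add: add.commute)
    then have "D k * (?q - 1) = D 1 * (?q powi k - 1)" by (simp add: algebra_simps)
    then show ?thesis using q by (simp add: geo_def field_simps)
  qed
  have "\<psi> (r, k) = (A 1 * r + D 1 * geo n k, \<epsilon> * k)" if "r \<in> loc n" for r k
    using form[OF that, of k] unfolding D_geo[of k] .
  then show thesis
    by (rule that[OF \<alpha> rk(1) \<beta> unit \<epsilon> q\<epsilon>])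
qed

text \<open>The hypotheses on \<open>\<epsilon>\<close> make \<open>geo n\<close> invariant under
  \<open>k \<mapsto> \<epsilon> * k\<close>. This invariance, together with \<open>geo_add\<close>,
  yields the homomorphism property and the explicit inverse.\<close>

lemma bs_model_iso_affine:
  assumes n: "n \<noteq> 0" "n \<noteq> 1" and loc: "\<alpha> \<in> loc n" "\<alpha>' \<in> loc n" "\<beta> \<in> loc n" and \<alpha>: "\<alpha> * \<alpha>' = 1"
    and \<epsilon>: "\<epsilon> = 1 \<or> \<epsilon> = -1" "of_int n powi \<epsilon> = (of_int n :: rat)"
  shows "(\<lambda>(r, k). (\<alpha> * r + \<beta> * geo n k, \<epsilon> * k)) \<in> iso (bs_model n) (bs_model n)"
proof (rule isoI)
  let ?q = "of_int n :: rat"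
  have q\<epsilon>: "?q powi (\<epsilon> * k) = ?q powi k" for k
    by (simp add: power_int_mult \<epsilon>(2))
  then have geo: "geo n (\<epsilon> * k) = geo n k" for k by (simp add: geo_def)
  have \<epsilon>2: "\<epsilon> * (\<epsilon> * k) = k" for k using \<epsilon>(1) by auto
  have \<alpha>1: "\<alpha> * (\<alpha>' * r) = r" "\<alpha>' * (\<alpha> * r) = r" for r
    using \<alpha> by (simp_all flip: mult.assoc) (simp add: mult.commute)
  show "(\<lambda>(r, k). (\<alpha> * r + \<beta> * geo n k, \<epsilon> * k)) \<in> hom (bs_model n) (bs_model n)"
    using loc n by (intro homI)
      (auto simp: geo_add q\<epsilon> q\<epsilon>[unfolded mult.commute[of \<epsilon>]] algebra_simps)
  show "bij_betw (\<lambda>(r, k). (\<alpha> * r + \<beta> * geo n k, \<epsilon> * k)) (carrier (bs_model n)) (carrier (bs_model n))"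
    by (rule bij_betw_byWitness[where f' = "\<lambda>(s, l). (\<alpha>' * (s - \<beta> * geo n l), \<epsilon> * l)"])
      (use loc n in \<open>auto simp: geo \<epsilon>2 \<alpha>1\<close>)
qed

lemma bs_model_orbit_iff:
  assumes n: "n \<noteq> 0" "n \<noteq> 1" and r: "r \<in> loc n"
  shows "(\<exists>\<psi>\<in>iso (bs_model n) (bs_model n). \<psi> (r, k) = (s, l)) \<longleftrightarrow>
    (l = k \<or> n = -1 \<and> l = - k) \<and> affine_orbit n r s (geo n k)"
proof
  assume "\<exists>\<psi>\<in>iso (bs_model n) (bs_model n). \<psi> (r, k) = (s, l)"
  then obtain \<psi> where \<psi>: "\<psi> \<in> iso (bs_model n) (bs_model n)" "\<psi> (r, k) = (s, l)" by blast
  obtain \<alpha> \<alpha>' \<beta> \<epsilon> where *: "\<alpha> \<in> loc n" "\<alpha>' \<in> loc n" "\<beta> \<in> loc n" "\<alpha> * \<alpha>' = 1" "\<epsilon> = 1 \<or> \<epsilon> = -1"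
    "of_int n powi \<epsilon> = (of_int n :: rat)" "\<And>r k. r \<in> loc n \<Longrightarrow> \<psi> (r, k) = (\<alpha> * r + \<beta> * geo n k, \<epsilon> * k)"
    by (rule bs_model_iso_form[OF n \<psi>(1)]) blast
  \<comment> \<open>Here \<open>1 / n = n\<close>, so \<open>n * n = 1\<close>, and
    \<open>n = 1\<close> is excluded.\<close>
  have "n = -1" if "\<epsilon> = -1"
  proof -
    have "of_int (n * n) = (of_int 1 :: rat)" using *(6) that n by (simp add: field_simps)
    then have "n * n = 1" by (simp only: of_int_eq_iff)
    then show ?thesis using n by (auto simp: zmult_eq_1_iff)
  qed
  then show "(l = k \<or> n = -1 \<and> l = - k) \<and> affine_orbit n r s (geo n k)"
    using *(1-5) *(7)[OF r, of k] \<psi>(2) unfolding affine_orbit_def by auto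
next
  assume *: "(l = k \<or> n = -1 \<and> l = - k) \<and> affine_orbit n r s (geo n k)"
  then obtain \<alpha> \<alpha>' \<beta> where loc: "\<alpha> \<in> loc n" "\<alpha>' \<in> loc n" "\<beta> \<in> loc n" "\<alpha> * \<alpha>' = 1"
    and s: "\<alpha> * r + \<beta> * geo n k = s"
    by (auto simp: affine_orbit_def)
  obtain \<epsilon> :: int where \<epsilon>: "\<epsilon> = 1 \<or> \<epsilon> = -1" "of_int n powi \<epsilon> = (of_int n :: rat)" "l = \<epsilon> * k"
  proof (cases "l = k")
    case True
    then show ?thesis using that[of 1] by simp
  next
    case False
    then show ?thesis using * that[of "-1"] by simp
  qed
  show "\<exists>\<psi>\<in>iso (bs_model n) (bs_model n). \<psi> (r, k) = (s, l)"
    by (rule bexI[OF _ bs_model_iso_affine[OF n loc \<epsilon>(1,2)]]) (simp add: s \<epsilon>(3))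
qed

text \<open>Since \<open>n\<close> is a unit of \<int>[1/n], its powers can be absorbed into
  \<open>\<beta>\<close>; this serves to clear denominators.\<close>

lemma affine_orbit_scale:
  assumes n: "n \<noteq> 0"
  shows "affine_orbit n (r * of_int n ^ m) (s * of_int n ^ m) c \<longleftrightarrow> affine_orbit n r s c"
proof
  assume "affine_orbit n r s c"
  then obtain \<alpha> \<alpha>' \<beta> where *: "\<alpha> \<in> loc n" "\<alpha>' \<in> loc n" "\<beta> \<in> loc n" "\<alpha> * \<alpha>' = 1" "\<alpha> * r + \<beta> * c = s"
    by (auto simp: affine_orbit_def)
  have "\<beta> * of_int (n ^ m) \<in> loc n" using *(3) by (intro loc_mult of_int_loc)
  moreover have "\<alpha> * (r * of_int n ^ m) + (\<beta> * of_int (n ^ m)) * c = s * of_int n ^ m"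
    by (simp add: algebra_simps flip: *(5))
  ultimately show "affine_orbit n (r * of_int n ^ m) (s * of_int n ^ m) c"
    using *(1,2,4) unfolding affine_orbit_def by blast
next
  assume "affine_orbit n (r * of_int n ^ m) (s * of_int n ^ m) c"
  then obtain \<alpha> \<alpha>' \<beta> where *: "\<alpha> \<in> loc n" "\<alpha>' \<in> loc n" "\<beta> \<in> loc n" "\<alpha> * \<alpha>' = 1"
    "\<alpha> * (r * of_int n ^ m) + \<beta> * c = s * of_int n ^ m"
    by (auto simp: affine_orbit_def)
  have "\<beta> * of_int n powi (- int m) \<in> loc n" using *(3) n by simp
  moreover have "\<alpha> * r + (\<beta> * of_int n powi (- int m)) * c = s"
    using *(5) n by (simp add: power_int_minus field_simps)
  ultimately show "affine_orbit n r s c"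
    using *(1,2,4) unfolding affine_orbit_def by blast
qed

text \<open>A unit factor of \<open>c\<close> is absorbed into \<open>\<beta>\<close>.\<close>

lemma affine_orbit_associated:
  assumes "u \<in> loc n" "u' \<in> loc n" "u * u' = 1"
  shows "affine_orbit n r s (u * c) \<longleftrightarrow> affine_orbit n r s c"
proof -
  have "affine_orbit n r s c" if uc: "affine_orbit n r s (u * c)" "u \<in> loc n" for u c
  proof -
    obtain \<alpha> \<alpha>' \<beta> where *: "\<alpha> \<in> loc n" "\<alpha>' \<in> loc n" "\<beta> \<in> loc n" "\<alpha> * \<alpha>' = 1"
      "\<alpha> * r + \<beta> * (u * c) = s"
      using uc(1) by (auto simp: affine_orbit_def)
    have "\<beta> * u \<in> loc n" "\<alpha> * r + (\<beta> * u) * c = s" using *(3,5) uc(2) by (simp_all add: mult.assoc)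
    then show ?thesis using *(1,2,4) unfolding affine_orbit_def by blast
  qed
  moreover have "u' * (u * c) = (u * u') * c" by (simp only: mult_ac)
  then have "u' * (u * c) = c" by (simp only: assms(3) mult_1)
  ultimately show ?thesis
    using assms(1,2) by metis
qed

text \<open>Writing \<open>\<alpha>\<close>, \<open>\<alpha>'\<close> and \<open>\<beta>\<close> as
  fractions over powers of \<open>n\<close> turns the affine equation into an integer congruence;
  that \<open>\<alpha>\<close> is a unit becomes divisibility of its numerator into a power of
  \<open>n\<close>.\<close>

lemma affine_orbit_of_int_iff:
  assumes n: "n \<noteq> 0"
  shows "affine_orbit n (of_int x) (of_int y) (of_int c) \<longleftrightarrow> unit_cong n x y c"
proof
  assume "affine_orbit n (of_int x) (of_int y) (of_int c)"
  then obtain \<alpha> \<alpha>' \<beta> :: rat where *: "\<alpha> \<in> loc n" "\<alpha>' \<in> loc n" "\<beta> \<in> loc n" "\<alpha> * \<alpha>' = 1"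
    "\<alpha> * of_int x + \<beta> * of_int c = of_int y"
    by (auto simp: affine_orbit_def)
  obtain z a where z: "\<alpha> * of_int n ^ a = of_int z" using locE[OF *(1) n] .
  obtain w b where w: "\<alpha>' * of_int n ^ b = of_int w" using locE[OF *(2) n] .
  obtain g e where g: "\<beta> * of_int n ^ e = of_int g" using locE[OF *(3) n] .
  have "of_int (z * n ^ e * w) = (\<alpha> * \<alpha>') * (of_int n ^ (a + b + e) :: rat)"
    by (simp add: power_add mult_ac flip: z w)
  then have "of_int (z * n ^ e * w) = (of_int (n ^ (a + b + e)) :: rat)"
    by (simp add: *(4))
  then have "z * n ^ e * w = n ^ (a + b + e)" by (simp only: of_int_eq_iff)
  then have "z * n ^ e dvd n ^ (a + b + e)" by (metis dvd_triv_left)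
  moreover have "of_int (z * n ^ e * x - y * n ^ (a + e)) = (of_int (c * - (g * n ^ a)) :: rat)"
  proof -
    have "of_int (z * n ^ e * x - y * n ^ (a + e))
        = (\<alpha> * of_int x) * of_int n ^ (a + e) - of_int y * (of_int n ^ (a + e) :: rat)"
      by (simp add: power_add mult_ac flip: z)
    also have "\<dots> = - (\<beta> * of_int n ^ e) * (of_int c * of_int n ^ a)"
      by (simp add: power_add algebra_simps flip: *(5))
    finally show ?thesis by (simp add: g)
  qed
  then have "z * n ^ e * x - y * n ^ (a + e) = c * - (g * n ^ a)" by (simp only: of_int_eq_iff)
  then have "c dvd z * n ^ e * x - y * n ^ (a + e)" by (metis dvd_triv_left)
  ultimately show "unit_cong n x y c" unfolding unit_cong_def by blast
next
  assume "unit_cong n x y c"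
  then obtain z p j where z: "z dvd n ^ p" "c dvd z * x - y * n ^ j"
    by (auto simp: unit_cong_def)
  obtain w where w: "n ^ p = z * w" using z(1) by (elim dvdE)
  obtain g where g: "z * x - y * n ^ j = c * g" using z(2) by (elim dvdE)
  let ?q = "of_int n :: rat"
  \<comment> \<open>Dividing \<open>z * x - y * n ^ j = c * g\<close> by \<open>n ^ j\<close> gives
    \<open>\<alpha>\<close> and \<open>\<beta>\<close>; the inverse \<open>\<alpha>'\<close> comes
    from \<open>z * w = n ^ p\<close>.\<close>
  let ?\<alpha> = "of_int z * ?q powi (- int j)" and ?\<alpha>' = "of_int w * ?q powi (int j - int p)"
    and ?\<beta> = "of_int (- g) * ?q powi (- int j)"
  have zw: "of_int z * of_int w = ?q ^ p"
    using arg_cong[OF w, of "of_int :: int \<Rightarrow> rat"] by simp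
  have qq: "?q powi (- int j) * ?q powi (int j - int p) = ?q powi (- int p)"
    using n by (simp flip: power_int_add)
  have "?\<alpha> * ?\<alpha>' = (of_int z * of_int w) * (?q powi (- int j) * ?q powi (int j - int p))"
    by (simp only: mult_ac)
  then have 1: "?\<alpha> * ?\<alpha>' = 1"
    unfolding zw qq using n by (simp add: power_int_minus)
  have "of_int z * of_int x - of_int y * ?q ^ j = of_int c * of_int g"
    using arg_cong[OF g, of "of_int :: int \<Rightarrow> rat"] by simp
  then have 2: "?\<alpha> * of_int x + ?\<beta> * of_int c = of_int y"
    using n by (simp add: power_int_minus field_simps)
  have loc: "?\<alpha> \<in> loc n" "?\<alpha>' \<in> loc n" "?\<beta> \<in> loc n"
    using n by (intro loc_mult of_int_loc loc_power_int; simp)+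
  show "affine_orbit n (of_int x) (of_int y) (of_int c)"
    unfolding affine_orbit_def using 1 2 loc by blast
qed

lemma bs_model_orbit_unit_cong:
  assumes n: "n \<noteq> 0" "n \<noteq> 1"
  shows "(\<exists>\<psi>\<in>iso (bs_model n) (bs_model n). \<psi> (of_int x / of_int n ^ i, k) = (of_int y / of_int n ^ j, l)) \<longleftrightarrow>
    (l = k \<or> n = -1 \<and> l = - k) \<and> unit_cong n (x * n ^ j) (y * n ^ i) (\<Sum>e<nat \<bar>k\<bar>. n ^ e)"
proof -
  let ?q = "of_int n :: rat" and ?c = "of_int (\<Sum>e<nat \<bar>k\<bar>. n ^ e) :: rat"
  have "of_int x * ?q powi (- int i) \<in> loc n" using n by simp
  then have loc: "of_int x / ?q ^ i \<in> loc n"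
    by (simp add: power_int_minus divide_inverse)
  have "affine_orbit n (of_int x / ?q ^ i) (of_int y / ?q ^ j) (geo n k)
    \<longleftrightarrow> affine_orbit n (of_int x / ?q ^ i) (of_int y / ?q ^ j) ?c"
  proof (cases "k \<ge> 0")
    case True
    then show ?thesis using geo_nonneg[OF n(2), of k] by simp
  next
    case False
    \<comment> \<open>For negative \<open>k\<close> the value differs from that at
      \<open>\<bar>k\<bar>\<close> only by a unit.\<close>
    have "geo n k = (- (?q powi k)) * geo n (- k)"
      using geo_minus[OF n, of "- k"] by simp
    also have "geo n (- k) = ?c" using False geo_nonneg[OF n(2), of "- k"] by simp
    finally have "geo n k = (- (?q powi k)) * ?c" .
    moreover have "(- (?q powi k)) * (- (?q powi (- k))) = 1"
      using n by (simp add: power_int_minus)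
    ultimately show ?thesis
      using affine_orbit_associated[of "- (?q powi k)" n "- (?q powi (- k))"] n by simp
  qed
  also have "\<dots> \<longleftrightarrow> affine_orbit n (of_int x / ?q ^ i * ?q ^ (i + j)) (of_int y / ?q ^ j * ?q ^ (i + j)) ?c"
    by (rule affine_orbit_scale[OF n(1), symmetric])
  also have "of_int x / ?q ^ i * ?q ^ (i + j) = of_int (x * n ^ j)"
    using n by (simp add: power_add)
  also have "of_int y / ?q ^ j * ?q ^ (i + j) = of_int (y * n ^ i)"
    using n by (simp add: power_add)
  also have "affine_orbit n (of_int (x * n ^ j)) (of_int (y * n ^ i)) ?c \<longleftrightarrow>
      unit_cong n (x * n ^ j) (y * n ^ i) (\<Sum>e<nat \<bar>k\<bar>. n ^ e)"
    by (rule affine_orbit_of_int_iff[OF n(1)])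
  finally show ?thesis
    unfolding bs_model_orbit_iff[OF n loc] by blast
qed

section \<open>The case \<open>n = 1\<close>, where the group is \<int> \<times> \<int>\<close>

lemma loc_1: "loc 1 = \<int>"
  by (auto simp: loc_def)

lemma bs_model_1_pow:
  fixes x a b :: int
  shows "(of_int a, b) [^]\<^bsub>bs_model 1\<^esub> x = (of_int (x * a), x * b)"
proof -
  interpret group "bs_model 1" by (rule group_bs_model) simp
  have c: "(of_int a, b) \<in> carrier (bs_model 1)" by simp
  show ?thesis
  proof (induction x rule: int_induct[of _ 0])
    case (step1 i)
    then show ?case unfolding int_pow_mult[OF c] by (simp add: int_pow_1[OF c] algebra_simps)
  next
    case (step2 i)
    have "(of_int a, b) [^]\<^bsub>bs_model 1\<^esub> (i - 1)
        = (of_int a, b) [^]\<^bsub>bs_model 1\<^esub> i \<otimes>\<^bsub>bs_model 1\<^esub> inv\<^bsub>bs_model 1\<^esub> (of_int a, b)"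
      using int_pow_diff[OF c, of i 1] by (simp add: int_pow_1[OF c])
    then show ?case by (simp add: step2 bs_model_inv algebra_simps)
  qed simp
qed

text \<open>With \<open>d\<close> the gcd, \<open>(x, k)\<close> is a \<open>d\<close>-th power, and
  homomorphisms preserve \<open>d\<close>-th powers.\<close>

lemma bs_model_1_iso_dvd:
  assumes \<psi>: "\<psi> \<in> iso (bs_model 1) (bs_model 1)" and eq: "\<psi> (of_int x, k) = (of_int y, l)"
  shows "gcd x k dvd gcd y l"
proof -
  interpret group "bs_model 1" by (rule group_bs_model) simp
  interpret group_hom "bs_model 1" "bs_model 1" \<psi>
    using \<psi> by unfold_locales (simp add: iso_def)
  define d where "d = gcd x k"
  obtain x' k' where xk: "x = d * x'" "k = d * k'"
    unfolding d_def by (meson dvdE gcd_dvd1 gcd_dvd2)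
  have "\<psi> (of_int x', k') \<in> carrier (bs_model 1)" by (intro hom_closed) simp
  then obtain y' l' where y': "\<psi> (of_int x', k') = (of_int y', l')"
    by (auto simp: loc_1 elim: Ints_cases)
  have "(of_int y, l) = \<psi> ((of_int x', k') [^]\<^bsub>bs_model 1\<^esub> d)"
    unfolding bs_model_1_pow by (simp flip: eq xk)
  also have "\<dots> = (of_int y', l') [^]\<^bsub>bs_model 1\<^esub> d"
    unfolding y'[symmetric] by (rule hom_int_pow) simp
  finally have "of_int y = (of_int (d * y') :: rat)" "l = d * l'"
    unfolding bs_model_1_pow by simp_all
  then have "y = d * y'" "l = d * l'" by (simp_all only: of_int_eq_iff)
  then show ?thesis by (simp add: d_def[symmetric])
qed

text \<open>Integer matrices of determinant 1 act by automorphisms, with the adjugate as inverse.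
  The floor merely reads the integral first coordinate as an integer.\<close>

lemma bs_model_1_iso_matrix:
  fixes a b c d :: int
  assumes det: "a * d - b * c = 1"
  shows "(\<lambda>(r, k). (of_int (a * \<lfloor>r\<rfloor> + b * k), c * \<lfloor>r\<rfloor> + d * k)) \<in> iso (bs_model 1) (bs_model 1)"
proof (rule isoI)
  show "(\<lambda>(r, k). (of_int (a * \<lfloor>r\<rfloor> + b * k), c * \<lfloor>r\<rfloor> + d * k)) \<in> hom (bs_model 1) (bs_model 1)"
  proof (rule homI)
    fix p p' assume "p \<in> carrier (bs_model 1)" "p' \<in> carrier (bs_model 1)"
    then obtain x k x' k' where p: "p = (of_int x, k)" "p' = (of_int x', k')"
      by (auto simp: loc_1 elim!: Ints_cases)
    have "\<lfloor>of_int x + of_int x' :: rat\<rfloor> = x + x'" by (simp flip: of_int_add)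
    then show "(\<lambda>(r, k). (of_int (a * \<lfloor>r\<rfloor> + b * k), c * \<lfloor>r\<rfloor> + d * k)) (p \<otimes>\<^bsub>bs_model 1\<^esub> p')
        = (\<lambda>(r, k). (of_int (a * \<lfloor>r\<rfloor> + b * k), c * \<lfloor>r\<rfloor> + d * k)) p
          \<otimes>\<^bsub>bs_model 1\<^esub> (\<lambda>(r, k). (of_int (a * \<lfloor>r\<rfloor> + b * k), c * \<lfloor>r\<rfloor> + d * k)) p'"
      by (simp add: p algebra_simps)
  qed (auto simp del: of_int_add)
  have inv: "d * (a * x + b * k) + - b * (c * x + d * k) = x" "- c * (a * x + b * k) + a * (c * x + d * k) = k"
    "a * (d * x + - b * k) + b * (- c * x + a * k) = x" "c * (d * x + - b * k) + d * (- c * x + a * k) = k"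
    for x k
  proof -
    have "(a * d - b * c) * x = x" "(a * d - b * c) * k = k" by (simp_all add: det)
    then show "d * (a * x + b * k) + - b * (c * x + d * k) = x" "- c * (a * x + b * k) + a * (c * x + d * k) = k"
      "a * (d * x + - b * k) + b * (- c * x + a * k) = x" "c * (d * x + - b * k) + d * (- c * x + a * k) = k"
      by (simp_all add: algebra_simps)
  qed
  show "bij_betw (\<lambda>(r, k). (of_int (a * \<lfloor>r\<rfloor> + b * k), c * \<lfloor>r\<rfloor> + d * k)) (carrier (bs_model 1)) (carrier (bs_model 1))"
    by (rule bij_betw_byWitness[where f' = "\<lambda>(r, k). (of_int (d * \<lfloor>r\<rfloor> + - b * k), - c * \<lfloor>r\<rfloor> + a * k)"])
      (auto simp: loc_1 inv[simplified] simp del: of_int_add of_int_diff elim!: Ints_cases)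
qed

text \<open>An automorphism and its inverse give divisibility of the gcds in both directions.
  Conversely, both elements lie in the orbit of \<open>(g, 0)\<close> for their common gcd
  \<open>g\<close>.\<close>

lemma bs_model_1_orbit_iff:
  "(\<exists>\<psi>\<in>iso (bs_model 1) (bs_model 1). \<psi> (of_int x, k) = (of_int y, l)) \<longleftrightarrow> gcd x k = gcd y l"
proof
  assume "\<exists>\<psi>\<in>iso (bs_model 1) (bs_model 1). \<psi> (of_int x, k) = (of_int y, l)"
  then obtain \<psi> where \<psi>: "\<psi> \<in> iso (bs_model 1) (bs_model 1)" "\<psi> (of_int x, k) = (of_int y, l)"
    by blast
  interpret group "bs_model 1" by (rule group_bs_model) simp
  let ?\<eta> = "inv_into (carrier (bs_model 1)) \<psi>"
  have "?\<eta> \<in> iso (bs_model 1) (bs_model 1)" by (rule iso_set_sym[OF \<psi>(1)])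
  moreover have "?\<eta> (of_int y, l) = (of_int x, k)"
    using \<psi> unfolding \<psi>(2)[symmetric] by (intro inv_into_f_f) (auto simp: iso_def bij_betw_def)
  ultimately have "gcd y l dvd gcd x k" by (rule bs_model_1_iso_dvd)
  with bs_model_1_iso_dvd[OF \<psi>] show "gcd x k = gcd y l"
    by (simp add: zdvd_antisym_nonneg)
next
  assume gcd: "gcd x k = gcd y l"
  show "\<exists>\<psi>\<in>iso (bs_model 1) (bs_model 1). \<psi> (of_int x, k) = (of_int y, l)"
  proof (cases "gcd x k = 0")
    case True
    then have "x = 0" "k = 0" "y = 0" "l = 0" using gcd by simp_all
    then show ?thesis
      using bs_model_1_iso_matrix[of 1 1 0 0] by (intro bexI) auto
  next
    case False
    define g where "g = gcd x k"
    have g0: "g \<noteq> 0" using False by (simp only: g_def not_False_eq_True)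
    have bezout: "\<exists>x' k' p q. x = g * x' \<and> k = g * k' \<and> p * x' + q * k' = 1"
      if g: "g = gcd x k" "g \<noteq> 0" for x k :: int
    proof -
      obtain x' k' where xk: "x = g * x'" "k = g * k'"
        unfolding g by (meson dvdE gcd_dvd1 gcd_dvd2)
      obtain p q where "p * x + q * k = g" using bezout_int[of x k] g by blast
      then have "g * (p * x' + q * k') = g * 1" using xk by (simp add: algebra_simps)
      then show ?thesis using g(2) xk by (metis mult_cancel_left)
    qed
    obtain x' k' p q where x: "x = g * x'" "k = g * k'" "p * x' + q * k' = 1"
      using bezout[OF g_def g0] by blast
    obtain y' l' p' q' where y: "y = g * y'" "l = g * l'" "p' * y' + q' * l' = 1"
      using bezout[OF g_def[unfolded gcd] g0] by blast
    \<comment> \<open>The matrices have Bezout coefficients as entries: \<open>?f\<close> sends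
      \<open>(x, k)\<close> to \<open>(g, 0)\<close> and \<open>?h\<close> sends
      \<open>(g, 0)\<close> to \<open>(y, l)\<close>.\<close>
    let ?f = "\<lambda>(r :: rat, e). (of_int (p * \<lfloor>r\<rfloor> + q * e) :: rat, - k' * \<lfloor>r\<rfloor> + x' * e)"
    let ?h = "\<lambda>(r :: rat, e). (of_int (y' * \<lfloor>r\<rfloor> + - q' * e) :: rat, l' * \<lfloor>r\<rfloor> + p' * e)"
    have "?f \<in> iso (bs_model 1) (bs_model 1)"
      by (rule bs_model_1_iso_matrix) (use x(3) in simp)
    moreover have "?h \<in> iso (bs_model 1) (bs_model 1)"
      by (rule bs_model_1_iso_matrix) (use y(3) in \<open>simp add: mult.commute\<close>)
    ultimately have "?h \<circ> ?f \<in> iso (bs_model 1) (bs_model 1)" by (rule iso_set_trans)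
    moreover have "p * x + q * k = g" "- k' * x + x' * k = 0"
    proof -
      have "p * x + q * k = g * (p * x' + q * k')" by (simp add: x(1,2) algebra_simps)
      then show "p * x + q * k = g" by (simp add: x(3))
      show "- k' * x + x' * k = 0" by (simp add: x(1,2) algebra_simps)
    qed
    then have "(?h \<circ> ?f) (of_int x, k) = (of_int y, l)"
      by (simp add: y(1,2) del: of_int_add of_int_diff mult_minus_left)
    ultimately show ?thesis by blast
  qed
qed

text \<open>Gcds agree when the common divisors do, and it is enough to test the two gcds
  themselves, which lie within the bound. The value \<open>d = 0\<close> covers a vanishing gcd, as
  0 divides only 0.\<close>

lemma gcd_eq_iff_bounded:
  fixes x k y l :: int
  shows "gcd x k = gcd y l \<longleftrightarrow>
    (\<forall>d<Suc (nat \<bar>x\<bar> + nat \<bar>k\<bar> + nat \<bar>y\<bar> + nat \<bar>l\<bar>).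
      (int d dvd x \<and> int d dvd k) = (int d dvd y \<and> int d dvd l))" (is "_ \<longleftrightarrow> ?R")
proof
  assume ?R
  have le: "nat (gcd a b) \<le> nat \<bar>a\<bar> + nat \<bar>b\<bar>" for a b :: int
  proof (cases "a = 0")
    case False
    then have "gcd a b \<le> \<bar>a\<bar>" by (intro zdvd_imp_le) auto
    then show ?thesis by simp
  qed simp
  have "int (nat (gcd x k)) dvd y \<and> int (nat (gcd x k)) dvd l"
    using \<open>?R\<close>[rule_format, of "nat (gcd x k)"] le[of x k] by simp
  moreover have "int (nat (gcd y l)) dvd x \<and> int (nat (gcd y l)) dvd k"
    using \<open>?R\<close>[rule_format, of "nat (gcd y l)"] le[of y l] by simp
  ultimately show "gcd x k = gcd y l"
    by (intro zdvd_antisym_nonneg) simp_all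
next
  assume gcd: "gcd x k = gcd y l"
  have "(int d dvd x \<and> int d dvd k) = (int d dvd y \<and> int d dvd l)" for d
    unfolding gcd_greatest_iff[symmetric] gcd ..
  then show ?R by simp
qed

section \<open>The case \<open>n = 0\<close>, where \<open>a\<close> is trivial and the group is
  \<int>\<close>

lemma bs_rep_integer_group: "bs_rep integer_group 0 1 0"
proof -
  interpret group integer_group by simp
  show ?thesis by unfold_locales simp_all
qed

lemma integer_group_orbit_iff:
  "(\<exists>\<psi>\<in>iso integer_group integer_group. \<psi> k = l) \<longleftrightarrow> l = k \<or> l = - k"
proof
  assume "\<exists>\<psi>\<in>iso integer_group integer_group. \<psi> k = l"
  then obtain \<psi> where \<psi>: "\<psi> \<in> iso integer_group integer_group" "\<psi> k = l" by blast
  interpret group integer_group by simp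
  interpret group_hom integer_group integer_group \<psi>
    using \<psi> by unfold_locales (simp add: iso_def)
  have lin: "\<psi> m = m * \<psi> 1" for m
    using hom_int_pow[of 1 m] by simp
  have "1 \<in> range \<psi>" using \<psi>(1) by (simp add: iso_def bij_betw_def)
  then obtain m where "\<psi> m = 1" by force
  then have "m * \<psi> 1 = 1" using lin[of m] by simp
  then have "\<psi> 1 = 1 \<or> \<psi> 1 = -1" by (auto simp: zmult_eq_1_iff)
  then show "l = k \<or> l = - k" using lin[of k] \<psi>(2) by auto
next
  have id: "(\<lambda>m. m) \<in> iso integer_group integer_group"
    by (auto simp: iso_def hom_def bij_betw_def)
  have uminus: "uminus \<in> iso integer_group integer_group"
    by (auto simp: iso_def hom_def bij_betw_def)
  assume "l = k \<or> l = - k"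
  then show "\<exists>\<psi>\<in>iso integer_group integer_group. \<psi> k = l"
  proof
    assume "l = k"
    then show ?thesis by (intro bexI[OF _ id]) simp
  next
    assume "l = - k"
    then show ?thesis by (intro bexI[OF _ uminus]) simp
  qed
qed

lemma orbit_BS_0_iff:
  assumes u: "u \<in> words BS_gens" and v: "v \<in> words BS_gens"
    and nf: "nf 0 u = (x, i, j)" "nf 0 v = (x', i', j')"
  shows "(\<exists>\<phi>\<in>auto (BS 0). \<phi> (element_of BS_gens (BS_rels 0) u) = element_of BS_gens (BS_rels 0) v)
    \<longleftrightarrow> int j' - int i' = int j - int i \<or> int j' - int i' = - (int j - int i)"
proof -
  interpret bs_rep integer_group 0 1 0 by (rule bs_rep_integer_group)
  have val: "nf_val (r, i, j) = int j - int i" for r i j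
    by simp
  have "carrier integer_group \<subseteq> range nf_val"
  proof
    fix k :: int
    have "k = nf_val (0, nat (- k), nat k)" unfolding val by linarith
    then show "k \<in> range nf_val" by blast
  qed
  moreover have "i = j \<and> (0 = (0 :: int) \<or> r = 0)" if "nf_val (r, i, j) = \<one>\<^bsub>integer_group\<^esub>" for r i j
    using that unfolding val by simp
  ultimately show ?thesis
    using orbit_BS_iff[OF _ _ u v] integer_group_orbit_iff by (simp only: nf val)
qed

section \<open>The decision procedure\<close>

lemma computable_nf_step: "computable (\<lambda>z. nf_step n (fst z) (snd z))"
proof -
  have "nf_step n c p =
     (if c = 0 then (fst p + n ^ snd (snd p), snd p)
      else if c = 1 then (fst p - n ^ snd (snd p), snd p)
      else if c = 2 then (fst p, fst (snd p), Suc (snd (snd p)))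
      else if snd (snd p) = 0 then (n * fst p, Suc (fst (snd p)), 0)
      else (fst p, fst (snd p), snd (snd p) - 1))" for c p
    by (cases p) simp
  then show ?thesis
    by (simp only:) (intro computable_intros)
qed

text \<open>Normal forms are folds over the coded word, hence computable, so a decidable criterion
  on normal forms suffices.\<close>

lemma BS_orbit_decidableI:
  fixes P :: "int \<times> nat \<times> nat \<Rightarrow> int \<times> nat \<times> nat \<Rightarrow> bool"
  assumes P: "decidable (\<lambda>z. P (fst z) (snd z))"
    and orbit: "\<And>u v. u \<in> words BS_gens \<Longrightarrow> v \<in> words BS_gens \<Longrightarrow>
      (\<exists>\<phi>\<in>auto (BS n). \<phi> (element_of BS_gens (BS_rels n) u) = element_of BS_gens (BS_rels n) v)
      \<longleftrightarrow> P (nf n u) (nf n v)"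
  shows "orbit_decidable BS_gens (BS_rels n) (auto (BS n))"
proof -
  define N where "N c = fold (nf_step n) (list_decode c) (0, 0, 0)" for c
  have N: "N (word_code w) = nf n w" for w
    by (simp add: N_def nf_def word_code_def)
  have "computable (\<lambda>z. (N (fst z), N (snd z)))"
    unfolding N_def by (intro computable_intros computable_fold computable_nf_step)
  from decidable_comp[OF P this] have "decidable (\<lambda>z. P (N (fst z)) (N (snd z)))" by simp
  then obtain f where "recursive_fn 2 f" "\<And>c d. f [c, d] = (if P (N c) (N d) then 1 else 0)"
    by (rule recursive_fn_decidable) simp
  then show ?thesis
    unfolding orbit_decidable_def using orbit by (intro exI[of _ f]) (simp add: N)
qed

text \<open>All searches and exponents are bounded explicitly, which makes the condition decidable;
  for \<open>n \<noteq> 0\<close> it agrees with \<open>unit_cong\<close> when \<open>c\<close> is a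
  geometric sum.\<close>

definition unit_cong_test :: "int \<Rightarrow> int \<Rightarrow> int \<Rightarrow> int \<Rightarrow> bool" where
  "unit_cong_test n x y c \<longleftrightarrow>
     c = 0 \<and> x dvd y * n ^ nat \<bar>x\<bar> \<and> y dvd x * n ^ nat \<bar>y\<bar> \<or>
     c \<noteq> 0 \<and> (\<exists>w<Suc (nat (\<bar>n\<bar> ^ nat \<bar>c\<bar>)). int w dvd n ^ nat \<bar>c\<bar> \<and>
       (c dvd int w * x - y \<or> c dvd int w * x + y))"

lemma unit_cong_test:
  "n \<noteq> 0 \<Longrightarrow> unit_cong n x y (\<Sum>i<k. n ^ i) \<longleftrightarrow> unit_cong_test n x y (\<Sum>i<k. n ^ i)"
  unfolding unit_cong_test_def
  by (cases "(\<Sum>i<k. n ^ i) = 0") (simp_all add: unit_cong_0_iff unit_cong_geometric_iff)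

lemma decidable_unit_cong_test:
  "decidable (\<lambda>z. unit_cong_test n (fst z) (fst (snd z)) (snd (snd z)))"
  unfolding unit_cong_test_def by (intro computable_intros)

theorem theorem4p2:
  fixes n :: int
  shows "orbit_decidable BS_gens (BS_rels n) (auto (BS n))"
proof -
  \<comment> \<open>This is the total exponent of \<open>t\<close> in the normal form.\<close>
  let ?k = "\<lambda>p :: int \<times> nat \<times> nat. int (snd (snd p)) - int (fst (snd p))"
  consider "n = 0" | "n = 1" | "n \<noteq> 0" "n \<noteq> 1" by blast
  then show ?thesis
  proof cases
    case 1
    show ?thesis unfolding 1
    proof (rule BS_orbit_decidableI)
      show "decidable (\<lambda>z. ?k (snd z) = ?k (fst z) \<or> ?k (snd z) = - ?k (fst z))"
        by (intro computable_intros)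
    next
      fix u v assume uv: "u \<in> words BS_gens" "v \<in> words BS_gens"
      obtain x i j x' i' j' where nf: "nf 0 u = (x, i, j)" "nf 0 v = (x', i', j')"
        by (metis prod_cases3)
      show "(\<exists>\<phi>\<in>auto (BS 0). \<phi> (element_of BS_gens (BS_rels 0) u) = element_of BS_gens (BS_rels 0) v)
          \<longleftrightarrow> ?k (nf 0 v) = ?k (nf 0 u) \<or> ?k (nf 0 v) = - ?k (nf 0 u)"
        unfolding orbit_BS_0_iff[OF uv nf] by (simp only: nf fst_conv snd_conv)
    qed
  next
    case 2
    show ?thesis unfolding 2
    proof (rule BS_orbit_decidableI)
      show "decidable (\<lambda>z. \<forall>d<Suc (nat \<bar>fst (fst z)\<bar> + nat \<bar>?k (fst z)\<bar> + nat \<bar>fst (snd z)\<bar> + nat \<bar>?k (snd z)\<bar>).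
          (int d dvd fst (fst z) \<and> int d dvd ?k (fst z)) = (int d dvd fst (snd z) \<and> int d dvd ?k (snd z)))"
        by (intro computable_intros)
    next
      fix u v assume uv: "u \<in> words BS_gens" "v \<in> words BS_gens"
      obtain x i j x' i' j' where nf: "nf 1 u = (x, i, j)" "nf 1 v = (x', i', j')"
        by (metis prod_cases3)
      show "(\<exists>\<phi>\<in>auto (BS 1). \<phi> (element_of BS_gens (BS_rels 1) u) = element_of BS_gens (BS_rels 1) v)
          \<longleftrightarrow> (\<forall>d<Suc (nat \<bar>fst (nf 1 u)\<bar> + nat \<bar>?k (nf 1 u)\<bar> + nat \<bar>fst (nf 1 v)\<bar> + nat \<bar>?k (nf 1 v)\<bar>).
          (int d dvd fst (nf 1 u) \<and> int d dvd ?k (nf 1 u)) = (int d dvd fst (nf 1 v) \<and> int d dvd ?k (nf 1 v)))"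
        using orbit_BS_iff_bs_model[OF _ uv nf] bs_model_1_orbit_iff
        unfolding gcd_eq_iff_bounded[symmetric] by (simp add: nf)
    qed
  next
    case 3
    \<comment> \<open>The cross-multiplied numerators come from bringing the two first coordinates
      to a common denominator.\<close>
    let ?T = "\<lambda>p p'. unit_cong_test n (fst p * n ^ fst (snd p')) (fst p' * n ^ fst (snd p)) (\<Sum>e<nat \<bar>?k p\<bar>. n ^ e)"
    show ?thesis
    proof (rule BS_orbit_decidableI)
      have "computable (\<lambda>z. (fst (fst z) * n ^ fst (snd (snd z)), fst (snd z) * n ^ fst (snd (fst z)),
          \<Sum>e<nat \<bar>?k (fst z)\<bar>. n ^ e))"
        by (intro computable_intros computable_sum_int)
      from decidable_comp[OF decidable_unit_cong_test this]
      have T: "decidable (\<lambda>z. ?T (fst z) (snd z))" by simp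
      show "decidable (\<lambda>z. (?k (snd z) = ?k (fst z) \<or> n = -1 \<and> ?k (snd z) = - ?k (fst z)) \<and> ?T (fst z) (snd z))"
        by (intro computable_intros T)
    next
      fix u v assume uv: "u \<in> words BS_gens" "v \<in> words BS_gens"
      obtain x i j x' i' j' where nf: "nf n u = (x, i, j)" "nf n v = (x', i', j')"
        by (metis prod_cases3)
      show "(\<exists>\<phi>\<in>auto (BS n). \<phi> (element_of BS_gens (BS_rels n) u) = element_of BS_gens (BS_rels n) v)
          \<longleftrightarrow> (?k (nf n v) = ?k (nf n u) \<or> n = -1 \<and> ?k (nf n v) = - ?k (nf n u)) \<and> ?T (nf n u) (nf n v)"
        unfolding orbit_BS_iff_bs_model[OF 3(1) uv nf] bs_model_orbit_unit_cong[OF 3] unit_cong_test[OF 3(1)]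
        by (simp only: nf fst_conv snd_conv)
    qed
  qed
qed

end
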